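(* Let $T>0$. Assume that, for some $c\in[1,T+1)$, $\mathbf X_1,\dots,\mathbf X_{\lfloor mc\rfloor}$, denoted equivalently by $\mathbf Y_1,\dots,\mathbf Y_{\lfloor mc\rfloor}$, is a stretch from a stationary sequence $(\mathbf Y_i)_{i\in\mathbb{Z}}$ of continuous $d$-dimensional random vectors with contemporary d.f. $F$ whose strong mixing coefficients satisfy $\alpha_r^{\mathbf Y}=O(r^{-a})$ for some $a>1$ as $r\to\infty$, and that $\mathbf X_{\lfloor mc\rfloor+1},\dots,\mathbf X_{\lfloor m(T+1)\rfloor}$, denoted equivalently by $\mathbf Z_{\lfloor mc\rfloor+1},\dots,\mathbf Z_{\lfloor m(T+1)\rfloor}$, is a stretch from a stationary sequence $(\mathbf Z_i)_{i\in\mathbb{Z}}$ of continuous $d$-dimensional random vectors with contemporary d.f. $G\ne F$ whose strong mixing coefficients satisfy $\alpha_r^{\mathbf Z}=O(r^{-b})$ for some $b>1$ as $r\to\infty$. Then, as $m\to\infty$, $m^{-1/2}\mathbb{H}_m\to K_c$ in probability in $\ell^\infty(\Delta\times\mathbb{R}^d)$, where $$K_c(s,t,\mathbf x)=(s\wedge c)\{(t\vee c)-(s\vee c)\}\{F(\mathbf x)-G(\mathbf x)\},\qquad(s,t)\in\Delta,\ \mathbf x\in\mathbb{R}^d.$$ Consequently, $m^{-1/2}\mathbb{H}_{m,q}\to K_{c,q}$ in probability in $\ell^\infty(\Delta\times\mathbb{R}^d)$, where $K_{c,q}(s,t,\mathbf x)=K_c(s,t,\mathbf x)/q(s,t)$,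 $(s,t)\in\Delta$, $\mathbf x\in\mathbb{R}^d$, and $$\sup_{t\in[1,T+1]}\mathbb{R}_{m,q}(t)\to\infty,\qquad\sup_{t\in[1,T+1]}\mathbb{S}_{m,q}(t)\to\infty\qquad\text{and}\qquad\sup_{t\in[1,T+1]}\mathbb{T}_{m,q}(t)\to\infty$$ in probability.
   Context: Inequalities between vectors are componentwise. The contemporary d.f. of a stationary sequence is the d.f. of each of its elements. Strong mixing coefficients of a stationary sequence $(\mathbf V_i)_{i\in\mathbb{Z}}$: $\alpha_0^{\mathbf V}=1/2$ and $\alpha_r^{\mathbf V}=\sup_{A\in\mathcal F_{-\infty}^0,\,B\in\mathcal F_r^{+\infty}}|\Pr(A\cap B)-\Pr(A)\Pr(B)|$, $r\ge1$, where $\mathcal F_j^k$ is the $\sigma$-field generated by $(\mathbf V_i)_{j\le i\le k}$. Let $n=\lfloor m(T+1)\rfloor$. For integers $j,k\ge1$, $F_{j:k}(\mathbf x)=\frac1{k-j+1}\sum_{i=j}^k\mathbf 1(\mathbf X_i\le\mathbf x)$ if $j\le k$ and $F_{j:k}=0$ if $j>k$. $q(s,t)=\max\{s^\gamma(t-s)^\gamma,\delta\}$, $0\le s\le t$, with fixed $\delta\in(0,1)$ and $\gamma\in[0,1/2]$. $\Delta=\{(s,t)\in[0,T+1]^2:s\le t\}$ and $\lambda_m(s,t)=(\lfloor mt\rfloor-\lfloor ms\rfloor)/m$. For $(s,t)\in\Delta$ and $\mathbf x\in\mathbb{R}^d$, $\mathbb{H}_m(s,t,\mathbf x)=\sqrt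 m\,\lambda_m(0,s)\lambda_m(s,t)\{F_{1:\lfloor ms\rfloor}(\mathbf x)-F_{\lfloor ms\rfloor+1:\lfloor mt\rfloor}(\mathbf x)\}$ and $\mathbb{H}_{m,q}(s,t,\mathbf x)=\mathbb{H}_m(s,t,\mathbf x)/q\{\lambda_m(0,s),\lambda_m(0,t)\}$. Detectors: for $k\in\{m+1,\dots,n\}$, $R_{m,q}(k)=\max_{m\le j\le k-1}\frac{j(k-j)}{m^{3/2}q(j/m,k/m)}\sup_{\mathbf x\in\mathbb{R}^d}|F_{1:j}(\mathbf x)-F_{j+1:k}(\mathbf x)|$, $S_{m,q}(k)=\max_{m\le j\le k-1}\frac1k\sum_{i=1}^k\Big[\frac{j(k-j)}{m^{3/2}q(j/m,k/m)}\{F_{1:j}(\mathbf X_i)-F_{j+1:k}(\mathbf X_i)\}\Big]^2$, $T_{m,q}(k)=\frac1m\sum_{j=m}^{k-1}\frac1k\sum_{i=1}^k\Big[\frac{j(k-j)}{m^{3/2}q(j/m,k/m)}\{F_{1:j}(\mathbf X_i)-F_{j+1:k}(\mathbf X_i)\}\Big]^2$, and $R_{m,q}(m)=S_{m,q}(m)=T_{m,q}(m)=0$. For $t\in[1,T+1]$: $\mathbb{R}_{m,q}(t)=R_{m,q}(\lfloor mt\rfloor)$, $\mathbb{S}_{m,q}(t)=S_{m,q}(\lfloor mt\rfloor)$, $\mathbb{T}_{m,q}(t)=T_{m,q}(\lfloor mt\rfloor)$. $\ell^\infty(S)$ is the space of bounded real-valued functions on $S$ with the uniform metric; $\wedge$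 and $\vee$ are the minimum and maximum. *)

theory Defs
  imports "HOL-Probability.Probability" "HOL-Library.Landau_Symbols"
begin

section \<open>Stationary strongly mixing sequences\<close>

definition stationary_seq :: "'a measure \<Rightarrow> (int \<Rightarrow> 'a \<Rightarrow> real ^ 'd) \<Rightarrow> bool" where
  "stationary_seq M V \<longleftrightarrow>
     (\<forall>i. V i \<in> borel_measurable M) \<and>
     (\<forall>J h. finite J \<longrightarrow>
        distr M (Pi\<^sub>M J (\<lambda>_. borel)) (\<lambda>\<omega>. \<lambda>i\<in>J. V (i + h) \<omega>) =
        distr M (Pi\<^sub>M J (\<lambda>_. borel)) (\<lambda>\<omega>. \<lambda>i\<in>J. V i \<omega>))"

text \<open>The order on \<^typ>\<open>real ^ 'd\<close> is the componentwise one, so this is the multivariate d.f.\<close>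

definition dist_fun :: "'a measure \<Rightarrow> ('a \<Rightarrow> real ^ 'd) \<Rightarrow> real ^ 'd \<Rightarrow> real" where
  "dist_fun M V x = measure M {\<omega> \<in> space M. V \<omega> \<le> x}"

text \<open>
  A continuous random vector is one that has a Lebesgue density. For dimension at least 2 this is
  more than continuity of the d.f.; e.g. \<open>(U, - U)\<close> with \<open>U\<close> standard normal has a continuous d.f.
  but is not a continuous random vector.
\<close>

definition continuous_rv :: "'a measure \<Rightarrow> ('a \<Rightarrow> real ^ 'd) \<Rightarrow> bool" where
  "continuous_rv M V \<longleftrightarrow> (\<exists>f. distributed M lborel V f)"

definition gen_events :: "'a measure \<Rightarrow> (int \<Rightarrow> 'a \<Rightarrow> real ^ 'd) \<Rightarrow> int set \<Rightarrow> 'a set set" where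
  "gen_events M V I =
     sigma_sets (space M) {V i -` B \<inter> space M | i B. i \<in> I \<and> B \<in> sets borel}"

definition strong_mixing_coeff :: "'a measure \<Rightarrow> (int \<Rightarrow> 'a \<Rightarrow> real ^ 'd) \<Rightarrow> nat \<Rightarrow> real" where
  "strong_mixing_coeff M V r =
     (if r = 0 then 1 / 2
      else (SUP (A, B) \<in> gen_events M V {..0} \<times> gen_events M V {int r..}.
              \<bar>measure M (A \<inter> B) - measure M A * measure M B\<bar>))"


section \<open>Empirical processes\<close>

definition ecdf :: "(nat \<Rightarrow> real ^ 'd) \<Rightarrow> nat \<Rightarrow> nat \<Rightarrow> real ^ 'd \<Rightarrow> real" where
  "ecdf x j k y =
     (if j \<le> k then (\<Sum>i = j..k. of_bool (x i \<le> y)) / (real k - real j + 1) else 0)"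

text \<open>
  The case distinction implements \<open>0\<^sup>0 = 1\<close>, so that \<open>q = 1\<close> for \<open>\<gamma> = 0\<close>; the library has
  \<open>0 powr 0 = 0\<close>.
\<close>

definition qfun :: "real \<Rightarrow> real \<Rightarrow> real \<Rightarrow> real \<Rightarrow> real" where
  "qfun \<gamma> \<delta> s t = max (if \<gamma> = 0 then 1 else s powr \<gamma> * (t - s) powr \<gamma>) \<delta>"

definition Delta :: "real \<Rightarrow> (real \<times> real) set" where
  "Delta T = {(s, t). s \<in> {0..T + 1} \<and> t \<in> {0..T + 1} \<and> s \<le> t}"

definition lam :: "nat \<Rightarrow> real \<Rightarrow> real \<Rightarrow> real" where
  "lam m s t = real_of_int (\<lfloor>real m * t\<rfloor> - \<lfloor>real m * s\<rfloor>) / real m"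

definition H_proc :: "nat \<Rightarrow> (nat \<Rightarrow> real ^ 'd) \<Rightarrow> real \<Rightarrow> real \<Rightarrow> real ^ 'd \<Rightarrow> real" where
  "H_proc m x s t y =
     sqrt (real m) * lam m 0 s * lam m s t *
     (ecdf x 1 (nat \<lfloor>real m * s\<rfloor>) y - ecdf x (nat \<lfloor>real m * s\<rfloor> + 1) (nat \<lfloor>real m * t\<rfloor>) y)"

definition Hq_proc ::
  "real \<Rightarrow> real \<Rightarrow> nat \<Rightarrow> (nat \<Rightarrow> real ^ 'd) \<Rightarrow> real \<Rightarrow> real \<Rightarrow> real ^ 'd \<Rightarrow> real" where
  "Hq_proc \<gamma> \<delta> m x s t y = H_proc m x s t y / qfun \<gamma> \<delta> (lam m 0 s) (lam m 0 t)"

definition K_lim ::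
  "real \<Rightarrow> (real ^ 'd \<Rightarrow> real) \<Rightarrow> (real ^ 'd \<Rightarrow> real) \<Rightarrow> real \<Rightarrow> real \<Rightarrow> real ^ 'd \<Rightarrow> real" where
  "K_lim c F G s t y = min s c * (max t c - max s c) * (F y - G y)"

definition Kq_lim ::
  "real \<Rightarrow> real \<Rightarrow> real \<Rightarrow> (real ^ 'd \<Rightarrow> real) \<Rightarrow> (real ^ 'd \<Rightarrow> real) \<Rightarrow>
   real \<Rightarrow> real \<Rightarrow> real ^ 'd \<Rightarrow> real" where
  "Kq_lim \<gamma> \<delta> c F G s t y = K_lim c F G s t y / qfun \<gamma> \<delta> s t"


section \<open>Detectors\<close>

definition det_weight :: "real \<Rightarrow> real \<Rightarrow> nat \<Rightarrow> nat \<Rightarrow> nat \<Rightarrow> real" where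
  "det_weight \<gamma> \<delta> m j k =
     real j * (real k - real j) /
     (real m powr (3 / 2) * qfun \<gamma> \<delta> (real j / real m) (real k / real m))"

definition R_det :: "real \<Rightarrow> real \<Rightarrow> nat \<Rightarrow> (nat \<Rightarrow> real ^ 'd) \<Rightarrow> nat \<Rightarrow> real" where
  "R_det \<gamma> \<delta> m x k =
     (if k \<le> m then 0
      else (MAX j \<in> {m..k - 1}.
              det_weight \<gamma> \<delta> m j k * (SUP y. \<bar>ecdf x 1 j y - ecdf x (j + 1) k y\<bar>)))"

definition S_det :: "real \<Rightarrow> real \<Rightarrow> nat \<Rightarrow> (nat \<Rightarrow> real ^ 'd) \<Rightarrow> nat \<Rightarrow> real" where
  "S_det \<gamma> \<delta> m x k =
     (if k \<le> m then 0
      else (MAX j \<in> {m..k - 1}. 1 / real k *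
              (\<Sum>i = 1..k.
                 (det_weight \<gamma> \<delta> m j k * (ecdf x 1 j (x i) - ecdf x (j + 1) k (x i)))\<^sup>2)))"

definition T_det :: "real \<Rightarrow> real \<Rightarrow> nat \<Rightarrow> (nat \<Rightarrow> real ^ 'd) \<Rightarrow> nat \<Rightarrow> real" where
  "T_det \<gamma> \<delta> m x k =
     (if k \<le> m then 0
      else 1 / real m * (\<Sum>j = m..k - 1. 1 / real k *
              (\<Sum>i = 1..k.
                 (det_weight \<gamma> \<delta> m j k * (ecdf x 1 j (x i) - ecdf x (j + 1) k (x i)))\<^sup>2)))"

text \<open>The processes \<open>t \<mapsto> D \<lfloor>m t\<rfloor>\<close> attached to a detector \<open>D\<close>.\<close>

definition det_proc :: "(nat \<Rightarrow> real) \<Rightarrow> nat \<Rightarrow> real \<Rightarrow> real" where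
  "det_proc D m t = D (nat \<lfloor>real m * t\<rfloor>)"


section \<open>Convergence in probability\<close>

text \<open>
  Elements of \<open>\<ell>\<^sup>\<infinity>(S)\<close> are functions that are \<open>undefined\<close> outside of \<open>S\<close>,
  hence the use of \<^const>\<open>restrict\<close>.
\<close>

definition linf :: "'b set \<Rightarrow> ('b \<Rightarrow> real) metric" where
  "linf S = funspace S euclidean_metric"

definition restrict_Delta ::
  "real \<Rightarrow> (real \<Rightarrow> real \<Rightarrow> real ^ 'd \<Rightarrow> real) \<Rightarrow> (real \<times> real) \<times> (real ^ 'd) \<Rightarrow> real" where
  "restrict_Delta T f = restrict (\<lambda>((s, t), y). f s t y) (Delta T \<times> UNIV)"

text \<open>
  Outer probabilities make the following notions independent of measurability of the maps involved;
  for measurable events, \<^const>\<open>outer_measure_of\<close> is the probability itself. The membership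
  conditions are needed because distances between points outside of the space are arbitrary.
\<close>

definition converges_in_prob ::
  "'a measure \<Rightarrow> 'b metric \<Rightarrow> (nat \<Rightarrow> 'a \<Rightarrow> 'b) \<Rightarrow> 'b \<Rightarrow> bool" where
  "converges_in_prob M E W w \<longleftrightarrow>
     (\<forall>m. \<forall>\<omega>\<in>space M. W m \<omega> \<in> mspace E) \<and> w \<in> mspace E \<and>
     (\<forall>\<epsilon>>0. (\<lambda>m. outer_measure_of M {\<omega> \<in> space M. mdist E (W m \<omega>) w > \<epsilon>}) \<longlonglongrightarrow> 0)"

definition diverges_in_prob :: "'a measure \<Rightarrow> (nat \<Rightarrow> 'a \<Rightarrow> real) \<Rightarrow> bool" where
  "diverges_in_prob M W \<longleftrightarrow>
     (\<forall>C. (\<lambda>m. outer_measure_of M {\<omega> \<in> space M. W m \<omega> \<le> C}) \<longlonglongrightarrow> 0)"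

end

theory Submission
  imports Defs "HOL-Computational_Algebra.Polynomial"
begin

text \<open>
  Up to the change point the empirical counts are those of \<open>Y\<close>, afterwards increments of those of
  \<open>Z\<close>. Summability of the mixing coefficients gives a weak law for every Borel set through second
  moments; since the counts are monotone in time and in the orthant, finitely many brackets make the
  law uniform. With \<open>U s x\<close> the limit of the normalised count of the observations up to time \<open>s\<close>
  that are at most \<open>x\<close>, the process \<open>m\<^sup>-\<^sup>1\<^sup>/\<^sup>2 H\<^sub>m\<close> converges to \<open>t U s x - s U t x = K\<^sub>c s t x\<close>.

  All detectors are bounded below in terms of \<open>T\<^sub>m\<^sub>,\<^sub>q\<close> at \<open>k = n\<close>, which is driven by the observations \<open>x\<close>
  with \<open>F x \<noteq> G x\<close>. These have positive probability because the laws have densities: a density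
  vanishes almost everywhere on the zero set of its (signed) distribution function, so if \<open>F = G\<close> held
  almost surely under both laws, the two densities would agree. For distribution functions that are
  merely continuous this fails: \<open>(U, - U)\<close> with atomless \<open>U\<close> has d.f. zero on its own support.
\<close>

section \<open>Densities vanish on the zero set of their distribution function\<close>

text \<open>The averages in \<open>H_proc\<close> run over stretches whose lengths vanish near
  \<open>s = 0\<close> and \<open>s = t\<close>, where no law of large numbers controls them. The
  factors \<open>lam\<close> cancel these lengths exactly, so only counts divided by
  \<open>m\<close> remain. Counts are monotone, hence Chebyshev at finitely many times and sets
  replaces any maximal inequality. \<open>Y\<close> and \<open>Z\<close> share a probability space
  but nothing is assumed about their joint law: they meet only when two events of probability
  tending to one are intersected.

  The statement on densities avoids differentiation theorems. In one variable, Fubini alone yields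
  the chain rule for polynomials in the primitive, which is enough to approximate the indicator of
  \<open>{0}\<close>. In several variables the zero set is treated one coordinate at a time, with a
  signed density throughout since it is the difference of two densities that must vanish.

  The growth rates explain the order of the final argument: about \<open>m\<close> split points
  contribute squares of order \<open>m\<close> to \<open>T_det\<close>, which is then divided by
  \<open>m\<close>. So \<open>T_det\<close> and \<open>S_det\<close> grow at least linearly in
  \<open>m\<close>, and \<open>R_det\<close> at least like its square root.\<close>

lemma integrable_if:
  fixes h :: "'a \<Rightarrow> real"
  assumes "integrable M h" "{x \<in> space M. P x} \<in> sets M"
  shows "integrable M (\<lambda>x. if P x then h x else 0)"
proof -
  have "integrable M (\<lambda>x. h x * indicator {x \<in> space M. P x} x)"
    using assms(2,1) by (rule integrable_real_mult_indicator)
  also have "integrable M (\<lambda>x. h x * indicator {x \<in> space M. P x} x) \<longleftrightarrow> ?thesis"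
    by (rule Bochner_Integration.integrable_cong) auto
  finally show ?thesis .
qed

text \<open>Subtracting half-lines leaves \<open>u < s \<le> x\<close>; the closed interval, the
  form in which Fubini produces it later, differs from this by the null set
  \<open>{u}\<close>.\<close>

lemma integral_truncate_diff:
  fixes h :: "real \<Rightarrow> real"
  assumes [simp]: "integrable lborel h" and "u \<le> x"
  shows "(\<integral>s. (if u \<le> s \<and> s \<le> x then h s else 0) \<partial>lborel) =
         (\<integral>s. (if s \<le> x then h s else 0) \<partial>lborel) - (\<integral>s. (if s \<le> u then h s else 0) \<partial>lborel)"
proof -
  have "(\<integral>s. (if s \<le> x then h s else 0) \<partial>lborel) - (\<integral>s. (if s \<le> u then h s else 0) \<partial>lborel) =
        (\<integral>s. (if s \<le> x then h s else 0) - (if s \<le> u then h s else 0) \<partial>lborel)"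
    by (rule Bochner_Integration.integral_diff[symmetric]) (auto intro!: integrable_if)
  also have "\<dots> = (\<integral>s. (if u \<le> s \<and> s \<le> x then h s else 0) \<partial>lborel)"
  proof (rule integral_cong_AE)
    show "AE s in lborel. (if s \<le> x then h s else 0) - (if s \<le> u then h s else 0) =
            (if u \<le> s \<and> s \<le> x then h s else 0)"
      using AE_lborel_singleton[of u] by eventually_elim (use \<open>u \<le> x\<close> in auto)
  qed (use borel_measurable_integrable[OF assms(1)] in measurable)
  finally show ?thesis by simp
qed

text \<open>The positive and the negative part of \<open>g\<close> are densities of two finite
  measures with the same cdf, hence of the same measure. By uniqueness of densities the parts agree
  almost everywhere, and since they are never positive at once both vanish.\<close>

lemma AE_zero_if_integrals_atMost_zero:
  fixes g :: "real \<Rightarrow> real"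
  assumes g: "integrable lborel g"
    and zero: "\<And>x. (\<integral>s. (if s \<le> x then g s else 0) \<partial>lborel) = 0"
  shows "AE s in lborel. g s = 0"
proof -
  have [measurable]: "g \<in> borel_measurable borel"
    using borel_measurable_integrable[OF g] by simp
  define D where "D \<sigma> = density lborel (\<lambda>s. ennreal (max 0 (\<sigma> * g s)))" for \<sigma> :: real
  have int: "integrable lborel (\<lambda>s. max 0 (\<sigma> * g s))" for \<sigma>
    using g by (intro integrable_max) auto
  have emeas: "emeasure (D \<sigma>) A = ennreal (\<integral>s. (if s \<in> A then max 0 (\<sigma> * g s) else 0) \<partial>lborel)"
    if [measurable]: "A \<in> sets borel" for A \<sigma>
  proof -
    have "emeasure (D \<sigma>) A = (\<integral>\<^sup>+s. ennreal (if s \<in> A then max 0 (\<sigma> * g s) else 0) \<partial>lborel)"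
      unfolding D_def by (subst emeasure_density) (auto intro!: nn_integral_cong split: split_indicator)
    also have "\<dots> = ennreal (\<integral>s. (if s \<in> A then max 0 (\<sigma> * g s) else 0) \<partial>lborel)"
      by (rule nn_integral_eq_integral) (auto intro!: integrable_if int)
    finally show ?thesis .
  qed
  have fin: "finite_borel_measure (D \<sigma>)" for \<sigma>
  proof (intro finite_borel_measure.intro finite_measureI finite_borel_measure_axioms.intro)
    show "emeasure (D \<sigma>) (space (D \<sigma>)) \<noteq> \<infinity>"
      using emeas[of UNIV \<sigma>] by (simp add: D_def)
  qed (simp_all add: D_def)
  have "cdf (D 1) = cdf (D (- 1))"
  proof
    fix x
    have "(\<integral>s. (if s \<le> x then max 0 (1 * g s) else 0) \<partial>lborel) - (\<integral>s. (if s \<le> x then max 0 (- 1 * g s) else 0) \<partial>lborel)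
      = (\<integral>s. (if s \<le> x then max 0 (1 * g s) else 0) - (if s \<le> x then max 0 (- 1 * g s) else 0) \<partial>lborel)"
      by (rule Bochner_Integration.integral_diff[symmetric]; rule integrable_if[OF int]) auto
    also have "\<dots> = (\<integral>s. (if s \<le> x then g s else 0) \<partial>lborel)"
      by (rule Bochner_Integration.integral_cong) auto
    finally have "(\<integral>s. (if s \<le> x then max 0 (1 * g s) else 0) \<partial>lborel) =
        (\<integral>s. (if s \<le> x then max 0 (- 1 * g s) else 0) \<partial>lborel)"
      using zero by simp
    then show "cdf (D 1) x = cdf (D (- 1)) x"
      unfolding cdf_def measure_def using emeas[of "{..x}"] by simp
  qed
  then have "D 1 = D (- 1)" by (rule cdf_unique'[OF fin fin])
  then have "AE s in lborel. ennreal (max 0 (1 * g s)) = ennreal (max 0 (- 1 * g s))"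
    unfolding D_def by (intro sigma_finite_measure.density_unique[OF sigma_finite_lborel]) measurable
  then show ?thesis by eventually_elim (auto simp: max_def split: if_splits)
qed

section \<open>One dimension: a chain rule for primitives of integrable functions\<close>

locale lebesgue_primitive =
  fixes h H :: "real \<Rightarrow> real"
  assumes h: "integrable lborel h"
    and H_def: "\<And>x. H x = (\<integral>s. (if s \<le> x then h s else 0) \<partial>lborel)"
begin

lemma h_meas [measurable]: "h \<in> borel_measurable borel"
  using borel_measurable_integrable[OF h] by simp

lemma H_meas [measurable]: "H \<in> borel_measurable borel"
  unfolding H_def by measurable

lemma H_bound: "\<bar>H x\<bar> \<le> (\<integral>s. \<bar>h s\<bar> \<partial>lborel)"
  unfolding H_def
  by (rule order_trans[OF integral_abs_bound]) (intro integral_mono integrable_abs integrable_if h; auto)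

lemma integrable_bounded_mult:
  assumes [measurable]: "f \<in> borel_measurable borel" and "\<And>s. \<bar>f s\<bar> \<le> C"
  shows "integrable lborel (\<lambda>s. f s * h s)"
proof (rule Bochner_Integration.integrable_bound)
  show "integrable lborel (\<lambda>s. C * h s)" using h by simp
  have "\<bar>f s\<bar> * \<bar>h s\<bar> \<le> \<bar>C\<bar> * \<bar>h s\<bar>" for s
    using assms(2)[of s] by (intro mult_right_mono) auto
  then show "AE s in lborel. norm (f s * h s) \<le> norm (C * h s)"
    by (auto simp: abs_mult)
qed measurable

lemma integrable_H_power: "integrable lborel (\<lambda>s. H s ^ k * h s)"
proof (rule integrable_bounded_mult)
  show "\<bar>H s ^ k\<bar> \<le> (\<integral>s. \<bar>h s\<bar> \<partial>lborel) ^ k" for s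
    using power_mono[OF H_bound, of s k] by (simp add: power_abs)
qed measurable

text \<open>Integration by parts through Fubini: the induction hypothesis turns
  \<open>H s ^ Suc k\<close> into an integral over \<open>u \<le> s\<close>, and after exchanging
  the integrals the inner one, over \<open>u \<le> s \<le> x\<close>, equals
  \<open>H x - H u\<close>.\<close>

lemma chain_rule_power:
  "(real k + 1) * (\<integral>s. (if s \<le> x then H s ^ k * h s else 0) \<partial>lborel) = H x ^ Suc k"
proof (induction k arbitrary: x)
  case 0
  then show ?case by (simp add: H_def cong: if_cong)
next
  case (Suc k)
  define I where "I j = (\<integral>s. (if s \<le> x then H s ^ j * h s else 0) \<partial>lborel)" for j
  define f where "f s u = (if u \<le> s \<and> s \<le> x then h s * (H u ^ k * h u) else 0)" for s u
  have fm[measurable]: "case_prod f \<in> borel_measurable (borel \<Otimes>\<^sub>M borel)"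
    unfolding f_def by measurable
  have "integrable (lborel \<Otimes>\<^sub>M lborel) (\<lambda>(s, u). h s * (H u ^ k * h u))"
    apply (rule lborel_pair.Fubini_integrable)
    using h integrable_H_power[of k] by (auto simp: abs_mult intro!: integrable_mult_left integrable_abs)
  then have fi: "integrable (lborel \<Otimes>\<^sub>M lborel) (case_prod f)"
    by (rule Bochner_Integration.integrable_bound) (auto simp: f_def split_beta)
  have "I (Suc k) = (\<integral>s. (\<integral>u. (real k + 1) * f s u \<partial>lborel) \<partial>lborel)"
    unfolding I_def
  proof (rule Bochner_Integration.integral_cong[OF refl])
    fix s
    have "(\<integral>u. f s u \<partial>lborel) = (\<integral>u. (if s \<le> x then h s else 0) * (if u \<le> s then H u ^ k * h u else 0) \<partial>lborel)"
      by (rule Bochner_Integration.integral_cong) (auto simp: f_def)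
    also have "\<dots> = (if s \<le> x then h s else 0) * (\<integral>u. (if u \<le> s then H u ^ k * h u else 0) \<partial>lborel)"
      by simp
    finally have "(real k + 1) * (\<integral>u. f s u \<partial>lborel) = (if s \<le> x then h s else 0) * H s ^ Suc k"
      using Suc[of s] by (simp add: ac_simps)
    then show "(if s \<le> x then H s ^ Suc k * h s else 0) = (\<integral>u. (real k + 1) * f s u \<partial>lborel)"
      by auto
  qed
  also have "\<dots> = (real k + 1) * (\<integral>s. (\<integral>u. f s u \<partial>lborel) \<partial>lborel)"
    by simp
  also have "(\<integral>s. (\<integral>u. f s u \<partial>lborel) \<partial>lborel) = (\<integral>u. (\<integral>s. f s u \<partial>lborel) \<partial>lborel)"
    by (rule lborel_pair.Fubini_integral[OF fi, symmetric])
  also have "\<dots> = (\<integral>u. (if u \<le> x then H x * (H u ^ k * h u) - H u ^ Suc k * h u else 0) \<partial>lborel)"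
  proof (rule Bochner_Integration.integral_cong[OF refl])
    fix u
    have "(\<integral>s. f s u \<partial>lborel) = (\<integral>s. (if u \<le> s \<and> s \<le> x then h s else 0) * (H u ^ k * h u) \<partial>lborel)"
      by (rule Bochner_Integration.integral_cong) (auto simp: f_def)
    also have "\<dots> = (\<integral>s. (if u \<le> s \<and> s \<le> x then h s else 0) \<partial>lborel) * (H u ^ k * h u)"
      by simp
    finally have eq: "(\<integral>s. f s u \<partial>lborel) = (\<integral>s. (if u \<le> s \<and> s \<le> x then h s else 0) \<partial>lborel) * (H u ^ k * h u)" .
    show "(\<integral>s. f s u \<partial>lborel) = (if u \<le> x then H x * (H u ^ k * h u) - H u ^ Suc k * h u else 0)"
    proof (cases "u \<le> x")
      case True
      have "(\<integral>s. (if u \<le> s \<and> s \<le> x then h s else 0) \<partial>lborel) = H x - H u"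
        using integral_truncate_diff[OF h True] by (simp add: H_def)
      show ?thesis
        unfolding eq \<open>_ = H x - H u\<close> using True by (simp add: algebra_simps)
    next
      case False
      then have "(\<lambda>s. if u \<le> s \<and> s \<le> x then h s else 0) = (\<lambda>s. 0)" by auto
      with False eq show ?thesis by simp
    qed
  qed
  also have "\<dots> = (\<integral>u. H x * (if u \<le> x then H u ^ k * h u else 0) - (if u \<le> x then H u ^ Suc k * h u else 0) \<partial>lborel)"
    by (rule Bochner_Integration.integral_cong) auto
  also have "\<dots> = H x * I k - I (Suc k)"
    unfolding I_def
    by (subst Bochner_Integration.integral_diff)
       (auto intro!: integrable_if integrable_mult_right integrable_H_power simp del: power_Suc)
  \<comment> \<open>The computation gives
    \<open>I (Suc k) = (real k + 1) * (H x * I k - I (Suc k))\<close>; the unknown integral stands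
    on both sides.\<close>
  finally have "(real k + 2) * I (Suc k) = H x * ((real k + 1) * I k)"
    by (simp add: algebra_simps)
  also have "(real k + 1) * I k = H x ^ Suc k"
    unfolding I_def by (rule Suc)
  finally show ?case by (simp add: I_def add.commute algebra_simps)
qed

lemma integrable_poly_H: "integrable lborel (\<lambda>s. poly p (H s) * h s)"
  unfolding poly_altdef sum_distrib_right
  by (auto intro!: Bochner_Integration.integrable_sum integrable_mult_right integrable_H_power simp: mult.assoc)

text \<open>Both sides are linear in \<open>p\<close>, so monomials suffice; for a constant both
  sides are zero.\<close>

lemma chain_rule_poly:
  "(\<integral>s. (if s \<le> x then poly (pderiv p) (H s) * h s else 0) \<partial>lborel) = poly p (H x) - poly p 0"
proof -
  have monom: "(\<integral>s. (if s \<le> x then poly (pderiv (monom c i)) (H s) * h s else 0) \<partial>lborel) =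
        poly (monom c i) (H x) - poly (monom c i) 0" for c i
  proof (cases i)
    case (Suc k)
    have "(\<integral>s. (if s \<le> x then poly (pderiv (monom c i)) (H s) * h s else 0) \<partial>lborel) =
        (\<integral>s. (c * (real k + 1)) * (if s \<le> x then H s ^ k * h s else 0) \<partial>lborel)"
      by (rule Bochner_Integration.integral_cong)
         (auto simp: Suc pderiv_monom poly_monom algebra_simps)
    also have "\<dots> = c * ((real k + 1) * (\<integral>s. (if s \<le> x then H s ^ k * h s else 0) \<partial>lborel))"
      by simp
    finally show ?thesis unfolding chain_rule_power by (simp add: Suc poly_monom)
  qed (simp add: monom_0 cong: if_cong)
  have "(\<integral>s. (if s \<le> x then poly (pderiv (\<Sum>i\<in>A. monom (coeff p i) i)) (H s) * h s else 0) \<partial>lborel) =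
        poly (\<Sum>i\<in>A. monom (coeff p i) i) (H x) - poly (\<Sum>i\<in>A. monom (coeff p i) i) 0" if "finite A" for A
    using that
  proof induction
    case (insert i A)
    have "(\<integral>s. (if s \<le> x then poly (pderiv (\<Sum>i\<in>insert i A. monom (coeff p i) i)) (H s) * h s else 0) \<partial>lborel) =
      (\<integral>s. (if s \<le> x then poly (pderiv (monom (coeff p i) i)) (H s) * h s else 0) +
        (if s \<le> x then poly (pderiv (\<Sum>i\<in>A. monom (coeff p i) i)) (H s) * h s else 0) \<partial>lborel)"
      by (rule Bochner_Integration.integral_cong) (auto simp: insert pderiv_add algebra_simps)
    also have "\<dots> = (\<integral>s. (if s \<le> x then poly (pderiv (monom (coeff p i) i)) (H s) * h s else 0) \<partial>lborel) +
        (\<integral>s. (if s \<le> x then poly (pderiv (\<Sum>i\<in>A. monom (coeff p i) i)) (H s) * h s else 0) \<partial>lborel)"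
      by (rule Bochner_Integration.integral_add) (auto intro!: integrable_if integrable_poly_H)
    finally show ?case using monom insert by simp
  qed (simp cong: if_cong)
  from this[of "{..degree p}"] show ?thesis by (simp only: poly_as_sum_of_monoms finite_atMost simp_thms)
qed

text \<open>The polynomials \<open>p\<^sub>n u = u (1 - (u/C)\<^sup>2)\<^sup>n\<^sup>+\<^sup>1\<close> tend to zero on \<open>[-C, C]\<close> while their derivatives
  tend boundedly to the indicator of \<open>{0}\<close>, so the chain rule shows that the integral of \<open>h\<close> over
  \<open>{H = 0} \<inter> (-\<infinity>, x]\<close> is zero.\<close>

lemma AE_primitive_zero_imp_zero: "AE s in lborel. H s = 0 \<longrightarrow> h s = 0"
proof -
  \<comment> \<open>The summand 1 makes \<open>C\<close> positive and
    \<open>\<bar>H s\<bar> < C\<close> strict, so \<open>1 - v s\<close> lies in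
    \<open>(0, 1]\<close> and its powers tend to zero wherever
    \<open>H s \<noteq> 0\<close>.\<close>
  define C where "C = (\<integral>s. \<bar>h s\<bar> \<partial>lborel) + 1"
  define v where "v s = (H s / C)\<^sup>2" for s
  have C: "C > 0" "\<bar>H s\<bar> < C" for s
    using H_bound[of s] Bochner_Integration.integral_nonneg[of lborel "\<lambda>s. \<bar>h s\<bar>"] by (auto simp: C_def add_nonneg_pos)
  have v: "0 \<le> v s" "v s < 1" "v s = 0 \<longleftrightarrow> H s = 0" for s
    using C(2)[of s] C(1) by (auto simp: v_def power_divide abs_le_square_iff abs_square_less_1 power2_less_0 field_simps
        power_strict_mono abs_less_iff power2_eq_square[symmetric] intro: power2_strict_mono)
  define p where "p n = [:0, 1:] * [:1, 0, - 1 / C\<^sup>2:] ^ Suc n" for n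
  have poly_p: "poly (p n) (H s) = H s * (1 - v s) ^ Suc n" for n s
    by (simp add: p_def v_def power_divide power2_eq_square algebra_simps)
  have poly_dp: "poly (pderiv (p n)) (H s) = (1 - v s) ^ Suc n - 2 * (real (Suc n) * v s * (1 - v s) ^ n)" for n s
  proof -
    have b: "poly [:1, 0, - 1 / C\<^sup>2:] (H s) = 1 - v s"
      by (simp add: v_def power_divide power2_eq_square)
    have d: "poly (pderiv [:1, 0, - 1 / C\<^sup>2:]) (H s) * H s = - 2 * v s"
      by (simp add: v_def power_divide power2_eq_square pderiv_pCons)
    have "poly (pderiv (p n)) (H s) =
        real (Suc n) * (1 - v s) ^ n * (poly (pderiv [:1, 0, - 1 / C\<^sup>2:]) (H s) * H s) + (1 - v s) ^ Suc n"
      unfolding p_def pderiv_mult pderiv_power_Suc poly_add poly_mult poly_power poly_smult b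
      by (simp add: pderiv_pCons)
    then show ?thesis unfolding d by simp
  qed
  \<comment> \<open>For \<open>n + 1\<close> independent trials with success probability
    \<open>w\<close>, exactly one success is at most as likely as at least one. This bounds the
    derivatives uniformly in \<open>n\<close>, as dominated convergence requires.\<close>
  have bern: "real (Suc n) * w * (1 - w) ^ n \<le> 1 - (1 - w) ^ Suc n" if "0 \<le> w" "w \<le> 1" for w :: real and n
  proof (induction n)
    case (Suc n)
    have "real (Suc (Suc n)) * w * (1 - w) ^ Suc n =
        (1 - w) * (real (Suc n) * w * (1 - w) ^ n) + w * (1 - w) ^ Suc n"
      by (simp add: algebra_simps)
    also have "\<dots> \<le> (1 - w) * (1 - (1 - w) ^ Suc n) + w * 1"
      using that Suc by (intro add_mono mult_left_mono power_le_one) auto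
    finally show ?case by (simp add: algebra_simps)
  qed simp
  have I0: "(\<integral>s. (if s \<le> x then (if H s = 0 then h s else 0) else 0) \<partial>lborel) = 0" for x
  proof (rule LIMSEQ_unique)
    show "(\<lambda>n. \<integral>s. (if s \<le> x then poly (pderiv (p n)) (H s) * h s else 0) \<partial>lborel)
        \<longlonglongrightarrow> (\<integral>s. (if s \<le> x then (if H s = 0 then h s else 0) else 0) \<partial>lborel)"
    proof (rule integral_dominated_convergence[where w="\<lambda>s. 3 * \<bar>h s\<bar>"])
      show "AE s in lborel. (\<lambda>n. if s \<le> x then poly (pderiv (p n)) (H s) * h s else 0)
          \<longlonglongrightarrow> (if s \<le> x then (if H s = 0 then h s else 0) else 0)"
      proof (rule AE_I2)
        fix s :: real
        have "(\<lambda>n. poly (pderiv (p n)) (H s)) \<longlonglongrightarrow> (if H s = 0 then 1 else 0)"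
        proof (cases "H s = 0")
          case True
          then show ?thesis unfolding poly_dp using v(3)[of s] by simp
        next
          case False
          then have "0 < v s" using v[of s] by linarith
          then have *: "norm (1 - v s) < 1" using v(2)[of s] by simp
          have "(\<lambda>n. (1 - v s) ^ Suc n - (2 * v s) * (real n * (1 - v s) ^ n + (1 - v s) ^ n)) \<longlonglongrightarrow>
              0 - (2 * v s) * (0 + 0)"
            using * by (intro tendsto_intros LIMSEQ_power_zero powser_times_n_limit_0
                LIMSEQ_Suc[of "\<lambda>n. (1 - v s) ^ n"])
          with False show ?thesis by (simp add: poly_dp algebra_simps)
        qed
        from tendsto_mult_right[OF this, of "h s"]
        show "(\<lambda>n. if s \<le> x then poly (pderiv (p n)) (H s) * h s else 0)
          \<longlonglongrightarrow> (if s \<le> x then (if H s = 0 then h s else 0) else 0)"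
          by (auto split: if_splits)
      qed
      have dp: "\<bar>poly (pderiv (p n)) (H s)\<bar> \<le> 3" for n s
      proof -
        have "0 \<le> (1 - v s) ^ Suc n" "(1 - v s) ^ Suc n \<le> 1"
          using v[of s] by (auto intro!: power_le_one zero_le_power simp del: power_Suc)
        moreover have "0 \<le> real (Suc n) * v s * (1 - v s) ^ n"
          using v[of s] by (intro mult_nonneg_nonneg zero_le_power) auto
        ultimately show ?thesis
          using bern[of "v s" n] v[of s] unfolding poly_dp by linarith
      qed
      show "AE s in lborel. norm (if s \<le> x then poly (pderiv (p n)) (H s) * h s else 0) \<le> 3 * \<bar>h s\<bar>" for n
        using dp by (auto intro!: AE_I2 mult_right_mono simp: abs_mult)
      show "(\<lambda>s. if s \<le> x then poly (pderiv (p n)) (H s) * h s else 0) \<in> borel_measurable lborel" for n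
        by (intro borel_measurable_integrable integrable_if integrable_poly_H) auto
    qed (use h in auto)
    have "(\<lambda>n. (1 - v x) ^ Suc n * H x) \<longlonglongrightarrow> 0"
    proof (cases "H x = 0")
      case False
      then have "0 < v x" using v[of x] by linarith
      then have "norm (1 - v x) < 1" using v(2)[of x] by simp
      then show ?thesis
        using LIMSEQ_Suc[OF LIMSEQ_power_zero, of "1 - v x"] by (intro tendsto_mult_left_zero)
    qed simp
    then show "(\<lambda>n. \<integral>s. (if s \<le> x then poly (pderiv (p n)) (H s) * h s else 0) \<partial>lborel) \<longlonglongrightarrow> 0"
      unfolding chain_rule_poly poly_p by (simp add: p_def mult.commute)
  qed
  have "AE s in lborel. (if H s = 0 then h s else 0) = 0"
    by (rule AE_zero_if_integrals_atMost_zero) (use h I0 in \<open>auto intro!: integrable_if\<close>)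
  then show ?thesis by eventually_elim (simp split: if_splits)
qed

end

section \<open>Several dimensions: induction over the coordinates\<close>

lemma distr_PiM_insert:
  assumes M: "product_sigma_finite M" and I: "finite I" "i \<notin> I"
  shows "distr (PiM I M \<Otimes>\<^sub>M M i) (PiM (insert i I) M) (\<lambda>(x, t). x(i := t)) = PiM (insert i I) M"
proof -
  interpret product_sigma_finite M by fact
  interpret I: finite_product_sigma_finite M I by standard fact
  have meas: "(\<lambda>(x, t). x(i := t)) \<in> PiM I M \<Otimes>\<^sub>M M i \<rightarrow>\<^sub>M PiM (insert i I) M"
    by (rule measurable_add_dim)
  show ?thesis
  proof (rule PiM_eqI)
    show "finite (insert i I)" using I by simp
    fix A assume A: "\<And>j. j \<in> insert i I \<Longrightarrow> A j \<in> sets (M j)"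
    have "emeasure (distr (PiM I M \<Otimes>\<^sub>M M i) (PiM (insert i I) M) (\<lambda>(x, t). x(i := t))) (Pi\<^sub>E (insert i I) A) =
        emeasure (PiM I M \<Otimes>\<^sub>M M i) ((\<lambda>(x, t). x(i := t)) -` Pi\<^sub>E (insert i I) A \<inter> space (PiM I M \<Otimes>\<^sub>M M i))"
      using A I by (intro emeasure_distr meas sets_PiM_I_finite) auto
    also have "(\<lambda>(x, t). x(i := t)) -` Pi\<^sub>E (insert i I) A \<inter> space (PiM I M \<Otimes>\<^sub>M M i) = Pi\<^sub>E I A \<times> A i"
      using A[THEN sets.sets_into_space] I(2)
      by (auto simp: space_pair_measure space_PiM PiE_iff extensional_def split: if_splits; metis)
    also have "emeasure (PiM I M \<Otimes>\<^sub>M M i) (Pi\<^sub>E I A \<times> A i) = emeasure (PiM I M) (Pi\<^sub>E I A) * emeasure (M i) (A i)"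
      using A I by (intro sigma_finite_measure.emeasure_pair_measure_Times[OF sigma_finite_measures] sets_PiM_I_finite) auto
    also have "\<dots> = (\<Prod>j\<in>insert i I. emeasure (M j) (A j))"
      using A I by (simp add: emeasure_PiM mult.commute)
    finally show "emeasure (distr (PiM I M \<Otimes>\<^sub>M M i) (PiM (insert i I) M) (\<lambda>(x, t). x(i := t))) (Pi\<^sub>E (insert i I) A) =
        (\<Prod>j\<in>insert i I. emeasure (M j) (A j))" .
  qed simp
qed

lemma pred_le_PiM:
  fixes f g :: "'a \<Rightarrow> 'i \<Rightarrow> real"
  assumes "finite I" "f \<in> M \<rightarrow>\<^sub>M PiM I (\<lambda>_. lborel)" "g \<in> M \<rightarrow>\<^sub>M PiM I (\<lambda>_. lborel)"
  shows "Measurable.pred M (\<lambda>x. \<forall>i\<in>I. f x i \<le> g x i)"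
proof (rule pred_intros_finite(3)[OF \<open>finite I\<close>])
  fix i assume "i \<in> I"
  then have c: "(\<lambda>x. x i) \<in> PiM I (\<lambda>_. lborel) \<rightarrow>\<^sub>M (borel :: real measure)"
    using measurable_component_singleton[of i I "\<lambda>_. lborel :: real measure"] by simp
  have [measurable]: "(\<lambda>x. f x i) \<in> borel_measurable M" "(\<lambda>x. g x i) \<in> borel_measurable M"
    using measurable_compose[OF assms(2) c] measurable_compose[OF assms(3) c] by auto
  show "Measurable.pred M (\<lambda>x. f x i \<le> g x i)" by measurable
qed

lemma pred_le_eucl [measurable (raw)]:
  fixes f g :: "'a \<Rightarrow> 'b::ordered_euclidean_space"
  assumes [measurable]: "f \<in> borel_measurable M" "g \<in> borel_measurable M"
  shows "Measurable.pred M (\<lambda>x. f x \<le> g x)"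
  unfolding eucl_le[where 'a='b] by (rule pred_intros_finite(3)) measurable

text \<open>Integrating out one coordinate gives a function \<open>h\<close> to which the induction hypothesis applies
  slicewise; the remaining coordinate is the one-dimensional case.\<close>

lemma AE_orthant_integral_zero_PiM:
  fixes g :: "('i \<Rightarrow> real) \<Rightarrow> real"
  assumes "finite I" "integrable (PiM I (\<lambda>_. lborel)) g"
  shows "AE x in PiM I (\<lambda>_. lborel).
    (\<integral>y. (if \<forall>i\<in>I. y i \<le> x i then g y else 0) \<partial>PiM I (\<lambda>_. lborel)) = 0 \<longrightarrow> g x = 0"
  using assms
proof (induction I arbitrary: g)
  case empty
  \<comment> \<open>Without coordinates the space is a single point and the orthant condition is
    void, so the integral is the value of \<open>g\<close> there.\<close>
  then show ?case
    unfolding PiM_empty AE_count_space by (simp add: lebesgue_integral_count_space_finite)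
next
  case (insert i I)
  let ?L = "\<lambda>_::'i. lborel :: real measure"
  define N where "N = PiM I ?L"
  define J where "J = insert i I"
  define \<phi> where "\<phi> = (\<lambda>(x, t). x(i := t) :: 'i \<Rightarrow> real)"
  interpret product_sigma_finite ?L ..
  interpret I: finite_product_sigma_finite ?L I by standard fact
  interpret N: sigma_finite_measure N unfolding N_def by (rule I.sigma_finite_measure_axioms)
  interpret P: pair_sigma_finite N "lborel :: real measure" ..
  have fin[measurable]: "finite I" "finite J" using insert by (auto simp: J_def)
  have \<phi>[measurable]: "\<phi> \<in> N \<Otimes>\<^sub>M lborel \<rightarrow>\<^sub>M PiM J ?L"
    unfolding \<phi>_def N_def J_def by (rule measurable_add_dim)
  have distr: "PiM J ?L = distr (N \<Otimes>\<^sub>M lborel) (PiM J ?L) \<phi>"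
    unfolding \<phi>_def N_def J_def using distr_PiM_insert[of ?L I i] insert
    by (simp add: product_sigma_finite_axioms)
  have [measurable]: "g \<in> borel_measurable (PiM J ?L)"
    using insert.prems unfolding J_def by (rule borel_measurable_integrable)
  define g' where "g' = g \<circ> \<phi>"
  have g'_meas[measurable]: "g' \<in> borel_measurable (N \<Otimes>\<^sub>M lborel)"
    unfolding g'_def by measurable
  have g': "integrable (N \<Otimes>\<^sub>M lborel) g'"
    unfolding g'_def comp_def
    by (rule integrable_distr[OF \<phi>]) (use insert.prems distr in \<open>simp add: J_def\<close>)
  have le[measurable (raw)]: "Measurable.pred K (\<lambda>w. \<forall>j\<in>I. f w j \<le> f' w j)"
    if "f \<in> K \<rightarrow>\<^sub>M N" "f' \<in> K \<rightarrow>\<^sub>M N" for K :: "'k measure" and f f'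
    using that unfolding N_def by (rule pred_le_PiM[OF fin(1)])
  have leJ[measurable (raw)]: "Measurable.pred K (\<lambda>w. \<forall>j\<in>J. f w j \<le> f' w j)"
    if "f \<in> K \<rightarrow>\<^sub>M PiM J ?L" "f' \<in> K \<rightarrow>\<^sub>M PiM J ?L" for K :: "'k measure" and f f'
    using that by (rule pred_le_PiM[OF fin(2)])
  \<comment> \<open>\<open>h\<close> integrates out the new coordinate up to \<open>snd z\<close>,
    and \<open>D\<close> integrates \<open>h\<close> over the orthant in the old ones, so
    \<open>D z\<close> is the full orthant integral (\<open>D_eq\<close>). Almost everywhere,
    \<open>D z = 0\<close> forces \<open>h z = 0\<close> by the induction hypothesis, and this
    forces \<open>g' z = 0\<close> by the one-dimensional case.\<close>
  define h where "h z = (\<integral>s. (if s \<le> snd z then g' (fst z, s) else 0) \<partial>lborel)" for z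
  have h_meas[measurable]: "h \<in> borel_measurable (N \<Otimes>\<^sub>M borel)"
    unfolding h_def by measurable
  define D where "D z = (\<integral>y. (if \<forall>j\<in>I. y j \<le> fst z j then h (y, snd z) else 0) \<partial>N)" for z
  have D_meas[measurable]: "D \<in> borel_measurable (N \<Otimes>\<^sub>M borel)"
    unfolding D_def by measurable
  have g'_cut: "integrable (N \<Otimes>\<^sub>M lborel) (\<lambda>(x, s). if s \<le> t then g' (x, s) else 0)" for t
    unfolding split_beta prod.collapse by (rule integrable_if[OF g']) measurable
  have h_int: "integrable N (\<lambda>x. h (x, t))" for t
    unfolding h_def fst_conv snd_conv using P.integrable_fst'[OF g'_cut[of t]] by simp
  \<comment> \<open>The null set from the induction hypothesis depends on \<open>t\<close>;
    measurability of the set of good pairs merges these null sets into one null set of the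
    product.\<close>
  have "AE t in lborel. AE x in N. D (x, t) = 0 \<longrightarrow> h (x, t) = 0"
  proof (rule AE_I2)
    fix t :: real
    show "AE x in N. D (x, t) = 0 \<longrightarrow> h (x, t) = 0"
      using insert.IH[OF h_int[of t, unfolded N_def]] unfolding D_def N_def fst_conv snd_conv .
  qed
  moreover have "{z \<in> space (N \<Otimes>\<^sub>M lborel). D (fst z, snd z) = 0 \<longrightarrow> h (fst z, snd z) = 0} \<in> sets (N \<Otimes>\<^sub>M lborel)"
    by measurable
  ultimately have "AE x in N. AE t in lborel. D (x, t) = 0 \<longrightarrow> h (x, t) = 0"
    by (subst P.AE_commute)
  then have AE1: "AE z in N \<Otimes>\<^sub>M lborel. D z = 0 \<longrightarrow> h z = 0"
    by (intro P.AE_pair_measure) measurable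
  \<comment> \<open>The one-dimensional case asks for an integrable slice, which Fubini supplies for
    almost every \<open>x\<close>.\<close>
  have "AE x in N. integrable lborel (\<lambda>t. g' (x, t))"
    using P.AE_integrable_fst'[OF g'] by simp
  then have "AE x in N. AE t in lborel. h (x, t) = 0 \<longrightarrow> g' (x, t) = 0"
    by eventually_elim (rule lebesgue_primitive.AE_primitive_zero_imp_zero, simp add: lebesgue_primitive_def h_def cong: if_cong)
  then have AE2: "AE z in N \<Otimes>\<^sub>M lborel. h z = 0 \<longrightarrow> g' z = 0"
    by (intro P.AE_pair_measure) measurable
  have D_eq: "(\<integral>y. (if \<forall>j\<in>J. y j \<le> \<phi> z j then g y else 0) \<partial>PiM J ?L) = D z"
    if z: "z \<in> space (N \<Otimes>\<^sub>M lborel)" for z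
  proof -
    have [measurable]: "(\<lambda>_. \<phi> z) \<in> PiM J ?L \<rightarrow>\<^sub>M PiM J ?L" "(\<lambda>_. fst z) \<in> N \<Otimes>\<^sub>M lborel \<rightarrow>\<^sub>M N"
      using z measurable_space[OF \<phi> z] by (auto simp: space_pair_measure)
    have "(\<integral>y. (if \<forall>j\<in>J. y j \<le> \<phi> z j then g y else 0) \<partial>PiM J ?L) =
        (\<integral>w. (if \<forall>j\<in>J. \<phi> w j \<le> \<phi> z j then g (\<phi> w) else 0) \<partial>(N \<Otimes>\<^sub>M lborel))"
      by (subst distr, rule integral_distr) measurable
    also have "\<dots> = (\<integral>w. (case w of (y, s) \<Rightarrow> if \<forall>j\<in>I. y j \<le> fst z j then (if s \<le> snd z then g' (y, s) else 0) else 0) \<partial>(N \<Otimes>\<^sub>M lborel))"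
      using insert.hyps
      by (intro Bochner_Integration.integral_cong) (auto simp: J_def \<phi>_def g'_def split_beta)
    also have "\<dots> = (\<integral>y. (\<integral>s. (if \<forall>j\<in>I. y j \<le> fst z j then (if s \<le> snd z then g' (y, s) else 0) else 0) \<partial>lborel) \<partial>N)"
    proof -
      have "integrable (N \<Otimes>\<^sub>M lborel) (\<lambda>(y, s). if \<forall>j\<in>I. y j \<le> fst z j then (if s \<le> snd z then g' (y, s) else 0) else 0)"
        unfolding split_beta
      proof (rule integrable_if[OF g'_cut[of "snd z", unfolded split_beta]])
        have "Measurable.pred (N \<Otimes>\<^sub>M lborel) (\<lambda>w. \<forall>j\<in>I. fst w j \<le> fst z j)"
          by measurable
        then show "{w \<in> space (N \<Otimes>\<^sub>M lborel). \<forall>j\<in>I. fst w j \<le> fst z j} \<in> sets (N \<Otimes>\<^sub>M lborel)"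
          by (rule predE)
      qed
      from P.integral_fst'[OF this, symmetric] show ?thesis unfolding prod.case .
    qed
    also have "\<dots> = D z"
      unfolding D_def h_def
    proof (rule Bochner_Integration.integral_cong[OF refl])
      have "(\<integral>s. (if b then f s else 0) \<partial>lborel) = (if b then integral\<^sup>L lborel f else 0)"
        for b and f :: "real \<Rightarrow> real"
        by simp
      then show "(\<integral>s. (if \<forall>j\<in>I. y j \<le> fst z j then (if s \<le> snd z then g' (y, s) else 0) else 0) \<partial>lborel) =
        (if \<forall>j\<in>I. y j \<le> fst z j then (\<integral>s. (if s \<le> snd (y, snd z) then g' (fst (y, snd z), s) else 0) \<partial>lborel) else 0)"
        for y
        unfolding fst_conv snd_conv .
    qed
    finally show ?thesis .
  qed
  have "AE x in distr (N \<Otimes>\<^sub>M lborel) (PiM J ?L) \<phi>.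
    (\<integral>y. (if \<forall>i\<in>J. y i \<le> x i then g y else 0) \<partial>PiM J ?L) = 0 \<longrightarrow> g x = 0"
  proof (subst AE_distr_iff)
    interpret Jp: finite_product_sigma_finite ?L J by standard fact
    show "{x \<in> space (PiM J ?L). (\<integral>y. (if \<forall>i\<in>J. y i \<le> x i then g y else 0) \<partial>PiM J ?L) = 0 \<longrightarrow> g x = 0}
        \<in> sets (PiM J ?L)"
      by measurable
    show "AE z in N \<Otimes>\<^sub>M lborel.
      (\<integral>y. (if \<forall>i\<in>J. y i \<le> \<phi> z i then g y else 0) \<partial>PiM J ?L) = 0 \<longrightarrow> g (\<phi> z) = 0"
      using AE1 AE2 AE_space by eventually_elim (auto simp: g'_def D_eq)
  qed (rule \<phi>)
  then show ?case
    unfolding distr[symmetric] unfolding J_def .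
qed

text \<open>Lebesgue measure is the image of the product measure under \<open>?f\<close>, which
  carries the coordinatewise order to the order of the space.\<close>

lemma AE_orthant_integral_zero:
  fixes g :: "'a::ordered_euclidean_space \<Rightarrow> real"
  assumes g: "integrable lborel g"
  shows "AE x in lborel. (\<integral>y. (if y \<le> x then g y else 0) \<partial>lborel) = 0 \<longrightarrow> g x = 0"
proof -
  let ?P = "\<Pi>\<^sub>M b\<in>(Basis::'a set). (lborel :: real measure)"
  let ?f = "\<lambda>x. \<Sum>b\<in>Basis. x b *\<^sub>R b :: 'a"
  have eq: "(lborel :: 'a measure) = distr ?P borel ?f" by (rule lborel_eq)
  have f[measurable]: "?f \<in> ?P \<rightarrow>\<^sub>M borel" by measurable
  have [measurable]: "g \<in> borel_measurable borel"
    using borel_measurable_integrable[OF g] by simp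
  have le: "?f y \<le> ?f x \<longleftrightarrow> (\<forall>b\<in>Basis. y b \<le> x b)" for x y
    by (subst eucl_le) simp
  have "integrable ?P (\<lambda>x. g (?f x))"
    by (rule integrable_distr[OF f]) (use g in \<open>simp add: eq[symmetric]\<close>)
  from AE_orthant_integral_zero_PiM[OF finite_Basis this]
  have "AE x in ?P. (\<integral>y. (if ?f y \<le> ?f x then g (?f y) else 0) \<partial>?P) = 0 \<longrightarrow> g (?f x) = 0"
    unfolding le .
  moreover have "(\<integral>y. (if ?f y \<le> x then g (?f y) else 0) \<partial>?P) = (\<integral>y. (if y \<le> x then g y else 0) \<partial>lborel)" for x
    unfolding eq by (subst integral_distr[OF f]) auto
  ultimately have "AE x in ?P. (\<integral>y. (if y \<le> ?f x then g y else 0) \<partial>lborel) = 0 \<longrightarrow> g (?f x) = 0"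
    by simp
  moreover have "{x \<in> space borel. (\<integral>y. (if y \<le> x then g y else 0) \<partial>lborel) = 0 \<longrightarrow> g x = 0} \<in> sets borel"
    by measurable
  ultimately have "AE x in distr ?P borel ?f. (\<integral>y. (if y \<le> x then g y else 0) \<partial>lborel) = 0 \<longrightarrow> g x = 0"
    by (subst AE_distr_iff[OF f]) auto
  then show ?thesis unfolding eq[symmetric] .
qed

section \<open>Events whose probability tends to one\<close>

text \<open>The failure event is measured from outside because the properties of interest quantify
  over uncountably many times and points.\<close>

definition whp :: "'a measure \<Rightarrow> (nat \<Rightarrow> 'a \<Rightarrow> bool) \<Rightarrow> bool" where
  "whp M Q \<longleftrightarrow> (\<lambda>m. outer_measure_of M {\<omega> \<in> space M. \<not> Q m \<omega>}) \<longlonglongrightarrow> 0"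

lemma whp_mono:
  assumes "whp M Q" "\<forall>\<^sub>F m in sequentially. \<forall>\<omega>\<in>space M. Q m \<omega> \<longrightarrow> R m \<omega>"
  shows "whp M R"
  unfolding whp_def
proof (rule tendsto_sandwich[OF _ _ tendsto_const])
  show "\<forall>\<^sub>F m in sequentially. outer_measure_of M {\<omega> \<in> space M. \<not> R m \<omega>} \<le> outer_measure_of M {\<omega> \<in> space M. \<not> Q m \<omega>}"
    using assms(2) by eventually_elim (auto intro!: outer_measure_of_mono)
qed (use assms(1) in \<open>auto simp: whp_def\<close>)

text \<open>Measurable covers attaining both outer measures reduce this to subadditivity of the
  measure.\<close>

lemma outer_measure_of_Un_le:
  assumes "A \<subseteq> space M" "B \<subseteq> space M"
  shows "outer_measure_of M (A \<union> B) \<le> outer_measure_of M A + outer_measure_of M B"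
proof -
  obtain E where E: "E \<in> sets M" "A \<subseteq> E" "outer_measure_of M A = emeasure M E"
    using outer_measure_of_attain[OF assms(1)] by blast
  obtain E' where E': "E' \<in> sets M" "B \<subseteq> E'" "outer_measure_of M B = emeasure M E'"
    using outer_measure_of_attain[OF assms(2)] by blast
  have "outer_measure_of M (A \<union> B) \<le> outer_measure_of M (E \<union> E')"
    using E E' by (intro outer_measure_of_mono) auto
  also have "\<dots> \<le> emeasure M E + emeasure M E'"
    using E E' by (auto intro!: emeasure_subadditive)
  finally show ?thesis using E E' by simp
qed

lemma whp_conj:
  assumes "whp M Q" "whp M R"
  shows "whp M (\<lambda>m \<omega>. Q m \<omega> \<and> R m \<omega>)"
  unfolding whp_def
proof (rule tendsto_sandwich[OF _ _ tendsto_const])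
  show "\<forall>\<^sub>F m in sequentially. outer_measure_of M {\<omega> \<in> space M. \<not> (Q m \<omega> \<and> R m \<omega>)} \<le>
      outer_measure_of M {\<omega> \<in> space M. \<not> Q m \<omega>} + outer_measure_of M {\<omega> \<in> space M. \<not> R m \<omega>}"
  proof (intro always_eventually allI)
    fix m
    have "{\<omega> \<in> space M. \<not> (Q m \<omega> \<and> R m \<omega>)} = {\<omega> \<in> space M. \<not> Q m \<omega>} \<union> {\<omega> \<in> space M. \<not> R m \<omega>}" by auto
    then show "outer_measure_of M {\<omega> \<in> space M. \<not> (Q m \<omega> \<and> R m \<omega>)} \<le>
      outer_measure_of M {\<omega> \<in> space M. \<not> Q m \<omega>} + outer_measure_of M {\<omega> \<in> space M. \<not> R m \<omega>}"
      using outer_measure_of_Un_le[of "{\<omega> \<in> space M. \<not> Q m \<omega>}" M "{\<omega> \<in> space M. \<not> R m \<omega>}"] by simp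
  qed
  show "(\<lambda>m. outer_measure_of M {\<omega> \<in> space M. \<not> Q m \<omega>} + outer_measure_of M {\<omega> \<in> space M. \<not> R m \<omega>}) \<longlonglongrightarrow> 0"
    using tendsto_add[OF assms[unfolded whp_def]] by simp
qed auto

lemma whp_ball_finite:
  assumes "finite I" "\<And>i. i \<in> I \<Longrightarrow> whp M (Q i)"
  shows "whp M (\<lambda>m \<omega>. \<forall>i\<in>I. Q i m \<omega>)"
  using assms
proof (induction I)
  case empty
  have "outer_measure_of M {} = 0" using outer_measure_of_eq[of "{}" M] by simp
  then show ?case by (simp add: whp_def)
next
  case (insert i I)
  then show ?case using whp_conj[of M "Q i"] by simp
qed

section \<open>Laws of large numbers under strong mixing\<close>

text \<open>Division is by \<open>m\<close>, not by the number of summands: this makes the count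
  additive over stretches and monotone in both \<open>s\<close> and \<open>B\<close>, which averages
  are not. For \<open>m = 0\<close> the value is zero.\<close>

definition emp :: "(nat \<Rightarrow> 'b) \<Rightarrow> nat \<Rightarrow> real \<Rightarrow> 'b set \<Rightarrow> real" where
  "emp x m s B = (\<Sum>i = 1..nat \<lfloor>real m * s\<rfloor>. of_bool (x i \<in> B)) / real m"

lemma floor_div_bounds:
  assumes "m > 0" "0 \<le> s"
  shows "real (nat \<lfloor>real m * s\<rfloor>) / real m \<le> s" "s - 1 / real m \<le> real (nat \<lfloor>real m * s\<rfloor>) / real m"
proof -
  have eq: "real (nat \<lfloor>real m * s\<rfloor>) = of_int \<lfloor>real m * s\<rfloor>" using assms by simp
  show "real (nat \<lfloor>real m * s\<rfloor>) / real m \<le> s"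
    unfolding eq using assms of_int_floor_le[of "real m * s"] by (simp add: divide_le_eq mult.commute del: of_int_floor_le)
  have "real m * s - 1 \<le> of_int \<lfloor>real m * s\<rfloor>" by linarith
  then have "(real m * s - 1) / real m \<le> of_int \<lfloor>real m * s\<rfloor> / real m"
    by (intro divide_right_mono) auto
  then show "s - 1 / real m \<le> real (nat \<lfloor>real m * s\<rfloor>) / real m"
    unfolding eq using assms by (simp add: diff_divide_distrib)
qed

lemma emp_mono:
  assumes "s \<le> s'" "A \<subseteq> B"
  shows "emp x m s A \<le> emp x m s' B"
  unfolding emp_def
proof (intro divide_right_mono)
  have "nat \<lfloor>real m * s\<rfloor> \<le> nat \<lfloor>real m * s'\<rfloor>"
    using assms(1) by (intro nat_mono floor_mono mult_left_mono) auto
  then have "(\<Sum>i = 1..nat \<lfloor>real m * s\<rfloor>. of_bool (x i \<in> A) :: real) \<le> (\<Sum>i = 1..nat \<lfloor>real m * s'\<rfloor>. of_bool (x i \<in> A))"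
    by (intro sum_mono2) auto
  also have "\<dots> \<le> (\<Sum>i = 1..nat \<lfloor>real m * s'\<rfloor>. of_bool (x i \<in> B))"
    using assms(2) by (intro sum_mono) auto
  finally show "(\<Sum>i = 1..nat \<lfloor>real m * s\<rfloor>. of_bool (x i \<in> A) :: real) \<le> (\<Sum>i = 1..nat \<lfloor>real m * s'\<rfloor>. of_bool (x i \<in> B))" .
qed simp

lemma emp_bounds:
  assumes "0 \<le> s"
  shows "0 \<le> emp x m s B" "emp x m s B \<le> s"
proof -
  show "0 \<le> emp x m s B" unfolding emp_def by (intro divide_nonneg_nonneg sum_nonneg) auto
  show "emp x m s B \<le> s"
  proof (cases "m = 0")
    case False
    have "(\<Sum>i = 1..nat \<lfloor>real m * s\<rfloor>. of_bool (x i \<in> B) :: real) \<le> (\<Sum>i = 1..nat \<lfloor>real m * s\<rfloor>. 1)"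
      by (intro sum_mono) auto
    then have "emp x m s B \<le> real (nat \<lfloor>real m * s\<rfloor>) / real m"
      unfolding emp_def by (intro divide_right_mono) auto
    then show ?thesis using floor_div_bounds(1)[of m s] assms False by linarith
  qed (use assms in \<open>simp add: emp_def\<close>)
qed

section \<open>Variance of counts under summable mixing coefficients\<close>

lemma sum_abs_diff_le_suminf:
  fixes f :: "nat \<Rightarrow> real"
  assumes "summable f" "\<And>r. 0 \<le> f r"
  shows "(\<Sum>i = 1..n. \<Sum>j = 1..n. f (nat \<bar>int i - int j\<bar>)) \<le> real n * (2 * suminf f)"
proof -
  have "(\<Sum>j = 1..n. f (nat \<bar>int i - int j\<bar>)) \<le> 2 * suminf f" if "i \<in> {1..n}" for i
  proof -
    \<comment> \<open>Cutting the row at the diagonal makes the lag injective on each half, so each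
      half is a finite part of the series.\<close>
    have "(\<Sum>j = 1..n. f (nat \<bar>int i - int j\<bar>)) = (\<Sum>j = 1..i. f (nat \<bar>int i - int j\<bar>)) + (\<Sum>j = Suc i..n. f (nat \<bar>int i - int j\<bar>))"
      using that by (subst sum.union_disjoint[symmetric]) (auto intro!: sum.cong)
    also have "(\<Sum>j = 1..i. f (nat \<bar>int i - int j\<bar>)) = sum f ((\<lambda>j. i - j) ` {1..i})"
      by (subst sum.reindex) (auto intro!: inj_onI sum.cong arg_cong[where f=f] simp: nat_diff_distrib)
    also have "\<dots> \<le> suminf f" by (intro sum_le_suminf) (auto simp: assms)
    also have "(\<Sum>j = Suc i..n. f (nat \<bar>int i - int j\<bar>)) = sum f ((\<lambda>j. j - i) ` {Suc i..n})"
      by (subst sum.reindex) (auto intro!: inj_onI sum.cong arg_cong[where f=f])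
    also have "\<dots> \<le> suminf f" by (intro sum_le_suminf) (auto simp: assms)
    finally show ?thesis by simp
  qed
  then have "(\<Sum>i = 1..n. \<Sum>j = 1..n. f (nat \<bar>int i - int j\<bar>)) \<le> (\<Sum>i = 1..n. 2 * suminf f)"
    by (rule sum_mono)
  then show ?thesis by simp
qed

locale mixing_seq = prob_space M for M :: "'a measure" +
  fixes V :: "int \<Rightarrow> 'a \<Rightarrow> real ^ 'd" and a :: real
  assumes stationary: "stationary_seq M V"
    and a: "a > 1"
    and mixing: "strong_mixing_coeff M V \<in> O(\<lambda>r. real r powr (- a))"
begin

lemma V_meas [measurable]: "V i \<in> borel_measurable M"
  using stationary by (simp add: stationary_seq_def)

lemma shift_invariant:
  assumes "finite J" and [measurable]: "B \<in> sets borel"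
  shows "prob {\<omega> \<in> space M. \<forall>j\<in>J. V (j + h) \<omega> \<in> B} = prob {\<omega> \<in> space M. \<forall>j\<in>J. V j \<omega> \<in> B}"
proof -
  have *: "prob {\<omega> \<in> space M. \<forall>j\<in>J. V (j + k) \<omega> \<in> B} =
    measure (distr M (Pi\<^sub>M J (\<lambda>_. borel)) (\<lambda>\<omega>. \<lambda>i\<in>J. V (i + k) \<omega>)) (Pi\<^sub>E J (\<lambda>_. B))" for k
  proof (subst measure_distr)
    show "(\<lambda>\<omega>. \<lambda>i\<in>J. V (i + k) \<omega>) \<in> M \<rightarrow>\<^sub>M Pi\<^sub>M J (\<lambda>_. borel)" by measurable
    show "Pi\<^sub>E J (\<lambda>_. B) \<in> sets (Pi\<^sub>M J (\<lambda>_. borel))"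
      using assms by (intro sets_PiM_I_finite) auto
  qed (auto intro!: arg_cong[where f=prob])
  have "distr M (Pi\<^sub>M J (\<lambda>_. borel)) (\<lambda>\<omega>. \<lambda>i\<in>J. V (i + h) \<omega>) = distr M (Pi\<^sub>M J (\<lambda>_. borel)) (\<lambda>\<omega>. \<lambda>i\<in>J. V i \<omega>)"
    using stationary assms(1) unfolding stationary_seq_def by blast
  then show ?thesis using *[of h] *[of 0] by simp
qed

lemma prob_stationary:
  assumes "B \<in> sets borel"
  shows "prob {\<omega> \<in> space M. V i \<omega> \<in> B} = prob {\<omega> \<in> space M. V 0 \<omega> \<in> B}"
  using shift_invariant[of "{0}" B i] assms by simp

lemma event_in_gen_events:
  "i \<in> I \<Longrightarrow> B \<in> sets borel \<Longrightarrow> {\<omega> \<in> space M. V i \<omega> \<in> B} \<in> gen_events M V I"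
  unfolding gen_events_def by (rule sigma_sets.Basic) blast

text \<open>Stationarity moves the pair to the times \<open>0\<close> and \<open>r\<close>, where
  the two events belong to the past and the future in the definition of the coefficient. At lag zero
  the left side is the variance of an indicator, which the conventional value 1/2 dominates.\<close>

lemma covariance_le_mixing_coeff:
  assumes [measurable]: "B \<in> sets borel"
  shows "\<bar>prob {\<omega> \<in> space M. V i \<omega> \<in> B \<and> V j \<omega> \<in> B} - (prob {\<omega> \<in> space M. V 0 \<omega> \<in> B})\<^sup>2\<bar>
    \<le> strong_mixing_coeff M V (nat \<bar>i - j\<bar>)"
proof (induction i j rule: linorder_wlog)
  case (le i j)
  show ?case
  proof (cases "i = j")
    case True
    have "\<bar>p - p\<^sup>2\<bar> \<le> 1 / 2" if "0 \<le> p" "p \<le> 1" for p :: real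
    proof -
      have "p\<^sup>2 \<le> p" using that by (simp add: power2_eq_square mult_left_le)
      moreover have "0 \<le> (p - 1 / 2)\<^sup>2" by simp
      ultimately show ?thesis by (simp add: power2_eq_square algebra_simps)
    qed
    then show ?thesis using True prob_stationary[OF assms, of j] by (simp add: strong_mixing_coeff_def)
  next
    case False
    define r where "r = nat (j - i)"
    have r: "r \<noteq> 0" "int r = j - i" using False le by (auto simp: r_def)
    let ?A = "{\<omega> \<in> space M. V 0 \<omega> \<in> B}" and ?C = "{\<omega> \<in> space M. V (int r) \<omega> \<in> B}"
    let ?f = "\<lambda>(A, B). \<bar>prob (A \<inter> B) - prob A * prob B\<bar>"
    have "?f (?A, ?C) \<le> (SUP z \<in> gen_events M V {..0} \<times> gen_events M V {int r..}. ?f z)"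
    proof (rule cSUP_upper)
      show "(?A, ?C) \<in> gen_events M V {..0} \<times> gen_events M V {int r..}"
        by (auto intro!: event_in_gen_events)
      \<comment> \<open>A real supremum is an upper bound only for a family that is bounded
        above.\<close>
      have "\<bar>prob (A \<inter> B) - prob A * prob B\<bar> \<le> 1" for A B
      proof -
        have "0 \<le> prob A * prob B" "prob A * prob B \<le> 1" by (auto intro: mult_le_one)
        moreover have "0 \<le> prob (A \<inter> B)" "prob (A \<inter> B) \<le> 1" by auto
        ultimately show ?thesis by linarith
      qed
      then show "bdd_above (?f ` (gen_events M V {..0} \<times> gen_events M V {int r..}))"
        by (intro bdd_aboveI[of _ 1]) auto
    qed
    also have "\<dots> = strong_mixing_coeff M V r"
      using r by (simp add: strong_mixing_coeff_def)
    finally have "\<bar>prob (?A \<inter> ?C) - (prob ?A)\<^sup>2\<bar> \<le> strong_mixing_coeff M V r"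
      using prob_stationary[OF assms, of "int r"] by (simp add: power2_eq_square)
    moreover have "prob (?A \<inter> ?C) = prob {\<omega> \<in> space M. V i \<omega> \<in> B \<and> V j \<omega> \<in> B}"
    proof -
      have "prob {\<omega> \<in> space M. V i \<omega> \<in> B \<and> V j \<omega> \<in> B} = prob {\<omega> \<in> space M. V 0 \<omega> \<in> B \<and> V (int r) \<omega> \<in> B}"
        using shift_invariant[of "{0, int r}" B i] r by simp
      also have "{\<omega> \<in> space M. V 0 \<omega> \<in> B \<and> V (int r) \<omega> \<in> B} = ?A \<inter> ?C" by auto
      finally show ?thesis by simp
    qed
    ultimately show ?thesis using r le by (simp add: r_def)
  qed
next
  case (sym i j)
  then show ?case by (simp add: abs_minus_commute conj_commute)
qed

text \<open>For the empty event the covariance bound has left side zero.\<close>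

lemma mixing_coeff_nonneg: "0 \<le> strong_mixing_coeff M V r"
  using covariance_le_mixing_coeff[of "{}" 0 "int r"] by simp

lemma summable_mixing_coeff: "summable (strong_mixing_coeff M V)"
proof (rule summable_comparison_test_bigo[OF _ mixing])
  show "summable (\<lambda>r. norm (real r powr - a))"
    using a by (simp add: summable_real_powr_iff)
qed

text \<open>The square expands into a double sum of covariances, each at most the mixing coefficient
  of its lag. Summability over the lags makes the bound linear in \<open>n\<close> instead of
  quadratic.\<close>

lemma second_moment_sum:
  assumes B[measurable]: "B \<in> sets borel"
  defines "p \<equiv> prob {\<omega> \<in> space M. V 0 \<omega> \<in> B}"
  shows "expectation (\<lambda>\<omega>. (\<Sum>i = 1..n. of_bool (V (int i) \<omega> \<in> B) - p)\<^sup>2)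
    \<le> real n * (2 * suminf (strong_mixing_coeff M V))"
proof -
  define \<xi> where "\<xi> i \<omega> = (of_bool (V (int i) \<omega> \<in> B) - p :: real)" for i \<omega>
  have int1: "integrable M (\<lambda>\<omega>. of_bool (P \<omega>) :: real)" if [measurable]: "Measurable.pred M P" for P
    by (rule integrable_const_bound[of _ 1]) auto
  have ex1: "expectation (\<lambda>\<omega>. of_bool (P \<omega>) :: real) = prob {\<omega> \<in> space M. P \<omega>}" if [measurable]: "Measurable.pred M P" for P
  proof -
    have "expectation (\<lambda>\<omega>. of_bool (P \<omega>) :: real) = expectation (indicator {\<omega> \<in> space M. P \<omega>})"
      by (rule Bochner_Integration.integral_cong) (auto simp: indicator_def)
    then show ?thesis by simp
  qed
  have \<xi>\<xi>: "\<xi> i \<omega> * \<xi> j \<omega> = of_bool (V (int i) \<omega> \<in> B \<and> V (int j) \<omega> \<in> B) - p * of_bool (V (int i) \<omega> \<in> B) - p * of_bool (V (int j) \<omega> \<in> B) + p\<^sup>2" for i j \<omega>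
    by (simp add: \<xi>_def algebra_simps power2_eq_square)
  have int2: "integrable M (\<lambda>\<omega>. \<xi> i \<omega> * \<xi> j \<omega>)" for i j
    unfolding \<xi>\<xi> by (intro Bochner_Integration.integrable_add Bochner_Integration.integrable_diff integrable_mult_right int1) auto
  have cov: "expectation (\<lambda>\<omega>. \<xi> i \<omega> * \<xi> j \<omega>) \<le> strong_mixing_coeff M V (nat \<bar>int i - int j\<bar>)" for i j
  proof -
    have "expectation (\<lambda>\<omega>. \<xi> i \<omega> * \<xi> j \<omega>) =
      prob {\<omega> \<in> space M. V (int i) \<omega> \<in> B \<and> V (int j) \<omega> \<in> B} - p * prob {\<omega> \<in> space M. V (int i) \<omega> \<in> B} - p * prob {\<omega> \<in> space M. V (int j) \<omega> \<in> B} + p\<^sup>2"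
      unfolding \<xi>\<xi>
      by (subst Bochner_Integration.integral_add Bochner_Integration.integral_diff integral_mult_right_zero ex1;
          (intro Bochner_Integration.integrable_add Bochner_Integration.integrable_diff integrable_mult_right int1)?; simp add: prob_space)+
    then show ?thesis
      using covariance_le_mixing_coeff[OF B, of "int i" "int j"]
      unfolding prob_stationary[OF B, of "int i"] prob_stationary[OF B, of "int j"] p_def[symmetric]
      by (simp add: power2_eq_square)
  qed
  have "expectation (\<lambda>\<omega>. (\<Sum>i = 1..n. \<xi> i \<omega>)\<^sup>2) = expectation (\<lambda>\<omega>. \<Sum>i = 1..n. \<Sum>j = 1..n. \<xi> i \<omega> * \<xi> j \<omega>)"
    by (simp add: power2_eq_square sum_product)
  also have "\<dots> = (\<Sum>i = 1..n. \<Sum>j = 1..n. expectation (\<lambda>\<omega>. \<xi> i \<omega> * \<xi> j \<omega>))"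
    using int2 by simp
  also have "\<dots> \<le> (\<Sum>i = 1..n. \<Sum>j = 1..n. strong_mixing_coeff M V (nat \<bar>int i - int j\<bar>))"
    by (intro sum_mono cov)
  also have "\<dots> \<le> real n * (2 * suminf (strong_mixing_coeff M V))"
    by (rule sum_abs_diff_le_suminf[OF summable_mixing_coeff mixing_coeff_nonneg])
  finally show ?thesis unfolding \<xi>_def .
qed

text \<open>Chebyshev's inequality with the linear variance bound. One half of
  \<open>\<epsilon>\<close> absorbs the centred sum, the other the replacement of the actual number
  of summands, divided by \<open>m\<close>, by \<open>s\<close>.\<close>

lemma weak_law:
  assumes B[measurable]: "B \<in> sets borel" and s: "0 \<le> s" and \<epsilon>: "0 < \<epsilon>"
  shows "whp M (\<lambda>m \<omega>. \<bar>emp (\<lambda>i. V (int i) \<omega>) m s B - s * prob {\<omega> \<in> space M. V 0 \<omega> \<in> B}\<bar> \<le> \<epsilon>)"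
proof -
  define p where "p = prob {\<omega> \<in> space M. V 0 \<omega> \<in> B}"
  define S where "S n \<omega> = (\<Sum>i = 1..n. of_bool (V (int i) \<omega> \<in> B) - p)" for n \<omega>
  define n where "n m = nat \<lfloor>real m * s\<rfloor>" for m
  define C where "C = 2 * suminf (strong_mixing_coeff M V)"
  have C: "0 \<le> C" unfolding C_def using mixing_coeff_nonneg by (simp add: suminf_nonneg summable_mixing_coeff)
  have [measurable]: "S n \<in> borel_measurable M" for n unfolding S_def by measurable
  have p: "0 \<le> p" "p \<le> 1" by (auto simp: p_def)
  have S_bound: "\<bar>S n \<omega>\<bar> \<le> real n" for n \<omega>
  proof -
    have "\<bar>S n \<omega>\<bar> \<le> (\<Sum>i = 1..n. \<bar>of_bool (V (int i) \<omega> \<in> B) - p\<bar>)" unfolding S_def by (rule sum_abs)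
    also have "\<dots> \<le> (\<Sum>i = 1..n. 1)" using p by (intro sum_mono) (auto simp: of_bool_def)
    finally show ?thesis by simp
  qed
  have S_int: "integrable M (\<lambda>\<omega>. (S n \<omega>)\<^sup>2)" for n
    by (rule integrable_const_bound[of _ "real n ^ 2"])
       (use S_bound in \<open>auto simp: abs_le_square_iff[symmetric]\<close>)
  have markov: "prob {\<omega> \<in> space M. \<not> \<bar>S (n m) \<omega>\<bar> \<le> real m * (\<epsilon> / 2)} \<le> 4 * s * C / \<epsilon>\<^sup>2 * (1 / real m)" if m: "m > 0" for m
  proof -
    define t where "t = (real m * (\<epsilon> / 2))\<^sup>2"
    have t: "t > 0" using m \<epsilon> by (simp add: t_def)
    have "prob {\<omega> \<in> space M. \<not> \<bar>S (n m) \<omega>\<bar> \<le> real m * (\<epsilon> / 2)} \<le> prob {\<omega> \<in> space M. t \<le> (S (n m) \<omega>)\<^sup>2}"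
      using m \<epsilon> by (intro finite_measure_mono) (auto simp: t_def abs_le_square_iff[symmetric])
    also have "\<dots> \<le> expectation (\<lambda>\<omega>. (S (n m) \<omega>)\<^sup>2) / t"
      using integral_Markov_inequality_measure[OF S_int[of "n m"], of "{}" t] t by simp
    also have "\<dots> \<le> real (n m) * C / t"
      using second_moment_sum[OF B, of "n m"] t unfolding S_def p_def C_def by (intro divide_right_mono) auto
    also have "\<dots> \<le> real m * s * C / t"
      using floor_div_bounds(1)[OF m s] C t m
      by (intro divide_right_mono mult_right_mono) (auto simp: n_def divide_le_eq mult.commute)
    also have "\<dots> = 4 * s * C / \<epsilon>\<^sup>2 * (1 / real m)"
      using m \<epsilon> by (simp add: t_def power2_eq_square field_simps)
    finally show ?thesis .
  qed
  have "whp M (\<lambda>m \<omega>. \<bar>S (n m) \<omega>\<bar> \<le> real m * (\<epsilon> / 2))"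
    unfolding whp_def
  proof (rule tendsto_sandwich[OF _ _ tendsto_const])
    show "\<forall>\<^sub>F m in sequentially. outer_measure_of M {\<omega> \<in> space M. \<not> \<bar>S (n m) \<omega>\<bar> \<le> real m * (\<epsilon> / 2)}
        \<le> ennreal (4 * s * C / \<epsilon>\<^sup>2 * (1 / real m))"
      using eventually_gt_at_top[of 0]
    proof eventually_elim
      case (elim m)
      then show ?case using markov[OF elim] by (simp add: emeasure_eq_measure ennreal_leI)
    qed
    have "(\<lambda>m. 4 * s * C / \<epsilon>\<^sup>2 * (1 / real m)) \<longlonglongrightarrow> 4 * s * C / \<epsilon>\<^sup>2 * 0"
      by (intro tendsto_intros lim_1_over_n)
    then show "(\<lambda>m. ennreal (4 * s * C / \<epsilon>\<^sup>2 * (1 / real m))) \<longlonglongrightarrow> 0"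
      using tendsto_ennrealI by fastforce
  qed auto
  then show ?thesis
  proof (rule whp_mono)
    \<comment> \<open>Rounding changes the time by at most \<open>1 / real m\<close>, which is below
      \<open>\<epsilon> / 2\<close> from here on.\<close>
    have "\<forall>\<^sub>F m in sequentially. 2 / \<epsilon> < real m" "\<forall>\<^sub>F m::nat in sequentially. 0 < m"
      by (real_asymp | simp add: eventually_gt_at_top)+
    then show "\<forall>\<^sub>F m in sequentially. \<forall>\<omega>\<in>space M. \<bar>S (n m) \<omega>\<bar> \<le> real m * (\<epsilon> / 2) \<longrightarrow>
        \<bar>emp (\<lambda>i. V (int i) \<omega>) m s B - s * prob {\<omega> \<in> space M. V 0 \<omega> \<in> B}\<bar> \<le> \<epsilon>"
    proof eventually_elim
      case (elim m)
      show ?case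
      proof (intro ballI impI)
        fix \<omega> assume "\<bar>S (n m) \<omega>\<bar> \<le> real m * (\<epsilon> / 2)"
        then have 1: "\<bar>S (n m) \<omega> / real m\<bar> \<le> \<epsilon> / 2"
          using elim by (simp add: divide_le_eq mult.commute)
        have eq: "emp (\<lambda>i. V (int i) \<omega>) m s B = S (n m) \<omega> / real m + real (n m) / real m * p"
          by (simp add: emp_def S_def n_def sum_subtractf diff_divide_distrib)
        have 2: "1 / real m \<le> \<epsilon> / 2" using elim \<epsilon> by (simp add: field_simps)
        have "\<bar>(real (n m) / real m - s) * p\<bar> \<le> 1 / real m * 1"
          unfolding abs_mult using floor_div_bounds[OF elim(2) s] p
          by (intro mult_mono) (auto simp: n_def abs_le_iff)
        moreover have "S (n m) \<omega> / real m + real (n m) / real m * p - s * p = S (n m) \<omega> / real m + (real (n m) / real m - s) * p"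
          by (simp add: algebra_simps)
        ultimately show "\<bar>emp (\<lambda>i. V (int i) \<omega>) m s B - s * prob {\<omega> \<in> space M. V 0 \<omega> \<in> B}\<bar> \<le> \<epsilon>"
          unfolding eq p_def[symmetric] using 1 2 by linarith
      qed
    qed
  qed
qed

end

section \<open>Finite brackets for half-lines and orthants\<close>

context real_distribution
begin

text \<open>Without atoms the cdf is continuous and takes every value \<open>k / N\<close>; the
  half-lines up to these quantiles cut the line into pieces of mass \<open>1 / N\<close>.\<close>

lemma brackets_atMost:
  assumes atomless: "\<And>x. measure M {x} = 0" and \<epsilon>: "0 < \<epsilon>"
  shows "\<exists>\<A>. finite \<A> \<and> \<A> \<subseteq> sets borel \<and>
    (\<forall>x. \<exists>A\<in>\<A>. \<exists>B\<in>\<A>. A \<subseteq> {..x} \<and> {..x} \<subseteq> B \<and> measure M (B - A) \<le> \<epsilon>)"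
proof -
  obtain N :: nat where N: "N > 0" "1 / real N \<le> \<epsilon>"
    using \<epsilon> by (metis real_arch_inverse inverse_eq_divide less_imp_le neq0_conv)
  have cont: "continuous_on UNIV (cdf M)"
    using isCont_cdf atomless by (simp add: continuous_on_eq_continuous_at)
  have "\<exists>t. cdf M t = real k / real N" if k: "0 < k" "k < N" for k
  proof -
    have r: "0 < real k / real N" "real k / real N < 1" using k by auto
    have "\<forall>\<^sub>F x in at_top. real k / real N < cdf M x"
      using order_tendstoD(1)[OF cdf_lim_at_top_prob r(2)] .
    then obtain u where u: "real k / real N < cdf M u" by (auto simp: eventually_at_top_linorder)
    have "\<forall>\<^sub>F x in at_bot. cdf M x < real k / real N"
      using order_tendstoD(2)[OF cdf_lim_at_bot r(1)] .
    then obtain l where l: "cdf M l < real k / real N" by (auto simp: eventually_at_bot_linorder)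
    have "l \<le> u" using u l cdf_nondecreasing[of u l] by linarith
    then show ?thesis
      using IVT'[of "cdf M" l "real k / real N" u] u l continuous_on_subset[OF cont] by auto
  qed
  then obtain t where t: "\<And>k. 0 < k \<Longrightarrow> k < N \<Longrightarrow> cdf M (t k) = real k / real N" by metis
  \<comment> \<open>The empty set and the whole line serve as outermost brackets, so that points
    beyond all quantiles are covered too.\<close>
  define A where "A k = (if k = 0 then {} else if k < N then {..t k} else UNIV)" for k
  have A_sets: "A k \<in> sets borel" for k by (simp add: A_def)
  have A_measure: "measure M (A k) = real k / real N" if "k \<le> N" for k
    using that t[of k] N(1) prob_space by (auto simp: A_def cdf_def)
  have "\<exists>A'\<in>A ` {..N}. \<exists>B\<in>A ` {..N}. A' \<subseteq> {..x} \<and> {..x} \<subseteq> B \<and> measure M (B - A') \<le> \<epsilon>" for x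
  proof -
    have "\<not> A N \<subseteq> {..x}" "\<not> \<not> A 0 \<subseteq> {..x}"
      using N(1) gt_ex[of x] by (auto simp: A_def not_le)
    from ex_least_nat_less[of "\<lambda>k. \<not> A k \<subseteq> {..x}", OF this]
    obtain k where k: "k < N" "A k \<subseteq> {..x}" "\<not> A (Suc k) \<subseteq> {..x}" by blast
    \<comment> \<open>Half-lines are nested: one that is not contained in \<open>{..x}\<close>
      contains it.\<close>
    have upper: "{..x} \<subseteq> A (Suc k)" using k(3) by (auto simp: A_def split: if_splits)
    have "measure M (A (Suc k) - A k) = measure M (A (Suc k)) - measure M (A k)"
      using k upper A_sets by (intro finite_measure_Diff) auto
    also have "\<dots> = 1 / real N"
      using k(1) by (simp add: A_measure diff_divide_distrib[symmetric])
    finally show ?thesis using k upper N(2) by (intro bexI[of _ "A k"] bexI[of _ "A (Suc k)"]) auto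
  qed
  moreover have "finite (A ` {..N})" "A ` {..N} \<subseteq> sets borel" using A_sets by auto
  ultimately show ?thesis
    by (intro exI[of _ "A ` {..N}"] conjI allI) simp_all
qed

end

text \<open>A coordinate hyperplane is a Lebesgue null set and \<open>V\<close> has a
  density.\<close>

lemma continuous_rv_component_atomless:
  assumes "continuous_rv M V"
  shows "measure M {\<omega> \<in> space M. V \<omega> $ i = t} = 0"
proof -
  obtain f where f: "distributed M lborel V f" using assms by (auto simp: continuous_rv_def)
  let ?P = "{x::real ^ 'b. x $ i = t}"
  have "closed ?P" by (intro closed_Collect_eq continuous_intros)
  then have P[measurable]: "?P \<in> sets borel" by simp
  have "negligible ?P"
    using negligible_standard_hyperplane[of "axis i 1 :: real ^ 'b" t]
    by (simp add: axis_in_Basis_iff cart_eq_inner_axis[symmetric])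
  then have "emeasure lborel ?P = 0"
    using P by (simp add: negligible_iff_null_sets null_sets_completion_iff null_sets_def)
  then have null: "AE x in lborel. x \<notin> ?P"
    using AE_not_in[of ?P lborel] by (simp add: null_sets_def)
  have "(\<integral>\<^sup>+x. f x * indicator ?P x \<partial>lborel) = (\<integral>\<^sup>+x. 0 \<partial>(lborel :: (real ^ 'b) measure))"
    by (rule nn_integral_cong_AE, use null in eventually_elim) auto
  then have "emeasure M (V -` ?P \<inter> space M) = 0"
    using distributed_emeasure[OF f, of ?P] by simp
  also have "V -` ?P \<inter> space M = {\<omega> \<in> space M. V \<omega> $ i = t}" by auto
  finally show ?thesis by (simp add: measure_def)
qed

text \<open>Boxes built from the brackets of the marginals bracket the orthants. A point between two
  such boxes lies between the brackets of some coordinate, so a union bound with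
  \<open>\<epsilon>\<close> divided by the dimension suffices, whatever the dependence between
  coordinates.\<close>

lemma (in prob_space) brackets_orthants:
  fixes V :: "'a \<Rightarrow> real ^ 'd"
  assumes V[measurable]: "V \<in> borel_measurable M" and cont: "continuous_rv M V" and \<epsilon>: "0 < \<epsilon>"
  shows "\<exists>\<A>. finite \<A> \<and> \<A> \<subseteq> sets borel \<and>
    (\<forall>y. \<exists>A\<in>\<A>. \<exists>B\<in>\<A>. A \<subseteq> {..y} \<and> {..y} \<subseteq> B \<and> prob {\<omega> \<in> space M. V \<omega> \<in> B - A} \<le> \<epsilon>)"
proof -
  define \<epsilon>' where "\<epsilon>' = \<epsilon> / real CARD('d)"
  have \<epsilon>': "0 < \<epsilon>'" using \<epsilon> by (simp add: \<epsilon>'_def)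
  have Vi: "(\<lambda>\<omega>. V \<omega> $ i) \<in> borel_measurable M" for i
    by (rule measurable_compose[OF V borel_measurable_continuous_onI]) (intro continuous_intros)
  note [measurable] = this
  have prob_comp: "measure (distr M borel (\<lambda>\<omega>. V \<omega> $ i)) S = prob {\<omega> \<in> space M. V \<omega> $ i \<in> S}"
    if "S \<in> sets borel" for S i
    using that by (subst measure_distr[OF Vi]) (auto intro!: arg_cong[where f=prob])
  have "\<exists>\<A>. finite \<A> \<and> \<A> \<subseteq> sets borel \<and> (\<forall>x. \<exists>A\<in>\<A>. \<exists>B\<in>\<A>. A \<subseteq> {..x} \<and> {..x} \<subseteq> B \<and>
      measure (distr M borel (\<lambda>\<omega>. V \<omega> $ i)) (B - A) \<le> \<epsilon>')" for i
  proof -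
    interpret D: real_distribution "distr M borel (\<lambda>\<omega>. V \<omega> $ i)"
      by (rule real_distribution_distr[OF Vi])
    show ?thesis
      using continuous_rv_component_atomless[OF cont]
      by (intro D.brackets_atMost[OF _ \<epsilon>']) (simp add: prob_comp)
  qed
  then obtain \<A> where fin: "\<And>i. finite (\<A> i)" and sets: "\<And>i. \<A> i \<subseteq> sets borel"
    and br: "\<And>i x. \<exists>A\<in>\<A> i. \<exists>B\<in>\<A> i. A \<subseteq> {..x} \<and> {..x} \<subseteq> B \<and>
      measure (distr M borel (\<lambda>\<omega>. V \<omega> $ i)) (B - A) \<le> \<epsilon>'"
    by metis
  define box where "box A = {v::real ^ 'd. \<forall>i. v $ i \<in> A i}" for A :: "'d \<Rightarrow> real set"
  let ?\<B> = "box ` (Pi\<^sub>E UNIV \<A>)"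
  have box_meas: "box A \<in> sets borel" if "A \<in> Pi\<^sub>E UNIV \<A>" for A
  proof -
    have [measurable]: "A i \<in> sets borel" for i using that sets[of i] by auto
    have [measurable]: "(\<lambda>v::real ^ 'd. v $ i) \<in> borel_measurable borel" for i
      by (rule borel_measurable_continuous_onI) (intro continuous_intros)
    have "{v \<in> space borel. \<forall>i. v $ i \<in> A i} \<in> sets (borel :: (real ^ 'd) measure)" by measurable
    then show ?thesis by (simp add: box_def)
  qed
  have "\<exists>A\<in>?\<B>. \<exists>B\<in>?\<B>. A \<subseteq> {..y} \<and> {..y} \<subseteq> B \<and> prob {\<omega> \<in> space M. V \<omega> \<in> B - A} \<le> \<epsilon>" for y :: "real ^ 'd"
  proof -
    obtain A B where AB: "\<And>i. A i \<in> \<A> i" "\<And>i. B i \<in> \<A> i" "\<And>i. A i \<subseteq> {..y $ i}" "\<And>i. {..y $ i} \<subseteq> B i"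
      "\<And>i. measure (distr M borel (\<lambda>\<omega>. V \<omega> $ i)) (B i - A i) \<le> \<epsilon>'"
    proof -
      have "\<exists>p. fst p \<in> \<A> i \<and> snd p \<in> \<A> i \<and> fst p \<subseteq> {..y $ i} \<and> {..y $ i} \<subseteq> snd p \<and>
          measure (distr M borel (\<lambda>\<omega>. V \<omega> $ i)) (snd p - fst p) \<le> \<epsilon>'" for i
        using br[of i "y $ i"] by auto
      then obtain p where "\<And>i. fst (p i) \<in> \<A> i \<and> snd (p i) \<in> \<A> i \<and> fst (p i) \<subseteq> {..y $ i} \<and> {..y $ i} \<subseteq> snd (p i) \<and>
          measure (distr M borel (\<lambda>\<omega>. V \<omega> $ i)) (snd (p i) - fst (p i)) \<le> \<epsilon>'"
        by metis
      then show ?thesis by (intro that[of "\<lambda>i. fst (p i)" "\<lambda>i. snd (p i)"]) blast+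
    qed
    have in_PiE: "A \<in> Pi\<^sub>E UNIV \<A>" "B \<in> Pi\<^sub>E UNIV \<A>" using AB by auto
    have [measurable]: "A i \<in> sets borel" "B i \<in> sets borel" for i using AB sets[of i] by auto
    have "prob {\<omega> \<in> space M. V \<omega> \<in> box B - box A} \<le> prob (\<Union>i. {\<omega> \<in> space M. V \<omega> $ i \<in> B i - A i})"
      by (intro finite_measure_mono) (auto simp: box_def)
    also have "\<dots> \<le> (\<Sum>i\<in>UNIV. prob {\<omega> \<in> space M. V \<omega> $ i \<in> B i - A i})"
      by (intro finite_measure_subadditive_finite) auto
    also have "\<dots> \<le> (\<Sum>i\<in>(UNIV::'d set). \<epsilon>')"
      using AB(5) prob_comp[of "B _ - A _"] by (intro sum_mono) auto
    also have "\<dots> = \<epsilon>" by (simp add: \<epsilon>'_def)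
    finally have "prob {\<omega> \<in> space M. V \<omega> \<in> box B - box A} \<le> \<epsilon>" .
    moreover have "box A \<subseteq> {..y}"
    proof
      fix v assume "v \<in> box A"
      then have "v $ i \<in> {..y $ i}" for i using AB(3)[of i] by (auto simp: box_def)
      then show "v \<in> {..y}" by (simp add: less_eq_vec_def)
    qed
    moreover have "{..y} \<subseteq> box B"
      by (auto simp: box_def less_eq_vec_def intro!: subsetD[OF AB(4)])
    ultimately show ?thesis using in_PiE by blast
  qed
  moreover have "finite ?\<B>" by (intro finite_imageI finite_PiE fin) auto
  moreover have "?\<B> \<subseteq> sets borel" using box_meas by auto
  ultimately show ?thesis
    by (intro exI[of _ "?\<B>"] conjI allI) simp_all
qed

section \<open>Uniformity in time and in the orthant\<close>

context mixing_seq
begin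

text \<open>A Glivenko-Cantelli argument with time as a further monotone variable: the count at
  \<open>s\<close> and \<open>{..y}\<close> lies between the counts at neighbouring grid times and
  bracketing sets, and these are finitely many.\<close>

lemma uniform_weak_law:
  assumes cont: "continuous_rv M (V 0)" and L: "0 \<le> L" and \<epsilon>: "0 < \<epsilon>"
  shows "whp M (\<lambda>m \<omega>. \<forall>s\<in>{0..L}. \<forall>y.
    \<bar>emp (\<lambda>i. V (int i) \<omega>) m s {..y} - s * dist_fun M (V 0) y\<bar> \<le> \<epsilon>)"
proof -
  define P where "P A = prob {\<omega> \<in> space M. V 0 \<omega> \<in> A}" for A
  \<comment> \<open>The error has three shares of \<open>\<epsilon> / 3\<close>: the weak law at a
    grid point, the bracket mass \<open>\<epsilon>'\<close> times a grid time of at most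
    \<open>L + 1\<close>, and the grid width \<open>\<eta>\<close>. The bound
    \<open>\<eta> \<le> 1\<close> is what keeps the upper grid time below
    \<open>L + 1\<close>.\<close>
  define \<epsilon>' where "\<epsilon>' = \<epsilon> / (3 * (L + 1))"
  define \<eta> where "\<eta> = min 1 (\<epsilon> / 3)"
  have \<epsilon>': "0 < \<epsilon>'" "(L + 1) * \<epsilon>' = \<epsilon> / 3" using \<epsilon> L by (auto simp: \<epsilon>'_def field_simps)
  have \<eta>: "0 < \<eta>" "\<eta> \<le> 1" "\<eta> \<le> \<epsilon> / 3" using \<epsilon> by (auto simp: \<eta>_def)
  obtain \<A> where "finite \<A> \<and> \<A> \<subseteq> sets borel \<and>
    (\<forall>y. \<exists>A\<in>\<A>. \<exists>B\<in>\<A>. A \<subseteq> {..y} \<and> {..y} \<subseteq> B \<and> prob {\<omega> \<in> space M. V 0 \<omega> \<in> B - A} \<le> \<epsilon>')"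
    using brackets_orthants[OF V_meas cont \<epsilon>'(1)] by (rule exE)
  then have \<A>: "finite \<A>" "\<A> \<subseteq> sets borel"
    "\<And>y. \<exists>A\<in>\<A>. \<exists>B\<in>\<A>. A \<subseteq> {..y} \<and> {..y} \<subseteq> B \<and> prob {\<omega> \<in> space M. V 0 \<omega> \<in> B - A} \<le> \<epsilon>'"
    by simp_all
  \<comment> \<open>The extra 1 keeps the grid point to the right of \<open>s\<close> among those
    controlled, even when \<open>s\<close> is close to \<open>L\<close>.\<close>
  define K where "K = nat \<lfloor>L / \<eta>\<rfloor> + 1"
  have "whp M (\<lambda>m \<omega>. \<forall>z\<in>{..K} \<times> \<A>. \<bar>emp (\<lambda>i. V (int i) \<omega>) m (real (fst z) * \<eta>) (snd z) - real (fst z) * \<eta> * P (snd z)\<bar> \<le> \<epsilon> / 3)"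
    unfolding P_def using \<A> \<eta> \<epsilon> by (intro whp_ball_finite weak_law) auto
  then show ?thesis
  proof (rule whp_mono, intro always_eventually allI ballI impI)
    fix m \<omega> s y
    assume "\<forall>z\<in>{..K} \<times> \<A>. \<bar>emp (\<lambda>i. V (int i) \<omega>) m (real (fst z) * \<eta>) (snd z) - real (fst z) * \<eta> * P (snd z)\<bar> \<le> \<epsilon> / 3"
    then have close: "\<bar>emp (\<lambda>i. V (int i) \<omega>) m (real k * \<eta>) A - real k * \<eta> * P A\<bar> \<le> \<epsilon> / 3"
      if "k \<le> K" "A \<in> \<A>" for k A
      using that by force
    assume s: "s \<in> {0..L}"
    define k where "k = nat \<lfloor>s / \<eta>\<rfloor>"
    have k_eq: "real k = of_int \<lfloor>s / \<eta>\<rfloor>" using s \<eta> by (simp add: k_def)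
    have "s / \<eta> \<le> L / \<eta>" using s \<eta> by (intro divide_right_mono) auto
    then have k: "k \<le> K" "Suc k \<le> K" unfolding k_def K_def using nat_mono[OF floor_mono] by force+
    have "real k \<le> s / \<eta>" "s / \<eta> \<le> real (Suc k)" using k_eq by linarith+
    then have ks: "real k * \<eta> \<le> s" "s \<le> real (Suc k) * \<eta>"
      using \<eta> by (auto simp: field_simps)
    have ks': "s - \<eta> \<le> real k * \<eta>" "real (Suc k) * \<eta> \<le> s + \<eta>"
      using ks by (auto simp: algebra_simps)
    obtain A B where AB: "A \<in> \<A>" "B \<in> \<A>" "A \<subseteq> {..y}" "{..y} \<subseteq> B" "prob {\<omega> \<in> space M. V 0 \<omega> \<in> B - A} \<le> \<epsilon>'"
      using \<A>(3) by blast
    have [measurable]: "A \<in> sets borel" "B \<in> sets borel" using AB \<A>(2) by auto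
    define F where "F = dist_fun M (V 0) y"
    have F_eq: "F = prob {\<omega> \<in> space M. V 0 \<omega> \<in> {..y}}" by (simp add: F_def dist_fun_def)
    have F: "0 \<le> F" "F \<le> 1" by (auto simp: F_eq)
    have "prob {\<omega> \<in> space M. V 0 \<omega> \<in> B - A} = P B - P A"
      unfolding P_def using AB(3,4)
      by (subst finite_measure_Diff[symmetric]) (auto intro!: arg_cong[where f=prob])
    moreover have "P A \<le> F" "F \<le> P B"
      unfolding P_def F_eq using AB(3,4) by (auto intro!: finite_measure_mono)
    ultimately have PB: "P B \<le> F + \<epsilon>'" and PA: "F - \<epsilon>' \<le> P A" using AB(5) by linarith+
    have "emp (\<lambda>i. V (int i) \<omega>) m s {..y} \<le> emp (\<lambda>i. V (int i) \<omega>) m (real (Suc k) * \<eta>) B"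
      using ks AB by (intro emp_mono) auto
    also have "\<dots> \<le> real (Suc k) * \<eta> * P B + \<epsilon> / 3"
      using close[OF k(2) AB(2)] by linarith
    also have "real (Suc k) * \<eta> * P B \<le> (s + \<eta>) * (F + \<epsilon>')"
      using ks' s \<eta> PB by (intro mult_mono) (auto simp: P_def)
    also have "\<dots> \<le> s * F + \<eta> + (L + 1) * \<epsilon>'"
    proof -
      have "\<eta> * F \<le> \<eta>" using F \<eta> by (simp add: mult_left_le)
      moreover have "(s + \<eta>) * \<epsilon>' \<le> (L + 1) * \<epsilon>'" using s \<eta> \<epsilon>' by (intro mult_right_mono) auto
      ultimately show ?thesis by (simp add: algebra_simps)
    qed
    finally have up: "emp (\<lambda>i. V (int i) \<omega>) m s {..y} \<le> s * F + \<epsilon>" using \<epsilon>' \<eta> by linarith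
    have "s * F - \<eta> - (L + 1) * \<epsilon>' \<le> real k * \<eta> * (F - \<epsilon>')"
    proof -
      have "s * F - \<eta> \<le> s * F - \<eta> * F" using F \<eta> by (simp add: mult_left_le)
      also have "\<dots> = (s - \<eta>) * F" by (simp add: algebra_simps)
      also have "\<dots> \<le> real k * \<eta> * F" using ks' F by (intro mult_right_mono) auto
      finally have "s * F - \<eta> \<le> real k * \<eta> * F" .
      moreover have "real k * \<eta> * \<epsilon>' \<le> (L + 1) * \<epsilon>'" using ks s \<epsilon>' by (intro mult_right_mono) auto
      ultimately show ?thesis by (simp add: algebra_simps)
    qed
    also have "\<dots> \<le> real k * \<eta> * P A" using PA \<eta> by (intro mult_left_mono) auto
    also have "\<dots> \<le> emp (\<lambda>i. V (int i) \<omega>) m (real k * \<eta>) A + \<epsilon> / 3"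
      using close[OF k(1) AB(1)] by linarith
    also have "emp (\<lambda>i. V (int i) \<omega>) m (real k * \<eta>) A \<le> emp (\<lambda>i. V (int i) \<omega>) m s {..y}"
      using ks AB by (intro emp_mono) auto
    finally have low: "s * F - \<epsilon> \<le> emp (\<lambda>i. V (int i) \<omega>) m s {..y}" using \<epsilon>' \<eta> by linarith
    show "\<bar>emp (\<lambda>i. V (int i) \<omega>) m s {..y} - s * dist_fun M (V 0) y\<bar> \<le> \<epsilon>"
      using up low unfolding F_def by linarith
  qed
qed

end

section \<open>Separation of the two distribution functions by the observations\<close>

text \<open>Densities are extended-real valued, but two of them must be subtracted. Total mass one
  makes them finite almost everywhere, so the real version loses nothing.\<close>

lemma (in prob_space) dist_fun_eq_integral:
  fixes V :: "'a \<Rightarrow> real ^ 'd"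
  assumes f: "distributed M lborel V f"
  shows "integrable lborel (\<lambda>x. enn2real (f x))" (is ?int)
    and "AE x in lborel. f x < \<top>" (is ?fin)
    and "dist_fun M V y = (\<integral>x. (if x \<le> y then enn2real (f x) else 0) \<partial>lborel)"
proof -
  have [measurable]: "f \<in> borel_measurable borel"
    using distributed_borel_measurable[OF f] by simp
  have total: "(\<integral>\<^sup>+x. f x \<partial>lborel) = 1"
    using distributed_emeasure[OF f, of UNIV] emeasure_space_1 by simp
  show fin: ?fin
  proof -
    have "AE x in lborel. f x \<noteq> \<infinity>"
      by (rule nn_integral_PInf_AE) (use total in auto)
    then show ?thesis by eventually_elim (simp add: less_top)
  qed
  have eq: "(\<integral>\<^sup>+x. ennreal (enn2real (f x)) \<partial>lborel) = 1"
    unfolding total[symmetric] by (rule nn_integral_cong_AE, use fin in eventually_elim) simp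
  show int: ?int
    by (rule integrableI_nonneg) (use eq in auto)
  have "emeasure M (V -` {..y} \<inter> space M) = (\<integral>\<^sup>+x. f x * indicator {..y} x \<partial>lborel)"
    by (rule distributed_emeasure[OF f]) simp
  also have "\<dots> = (\<integral>\<^sup>+x. ennreal (if x \<le> y then enn2real (f x) else 0) \<partial>lborel)"
    by (rule nn_integral_cong_AE, use fin in eventually_elim) (auto split: split_indicator)
  also have "\<dots> = ennreal (\<integral>x. (if x \<le> y then enn2real (f x) else 0) \<partial>lborel)"
    by (rule nn_integral_eq_integral) (auto intro!: integrable_if int)
  finally have "emeasure M (V -` {..y} \<inter> space M) = \<dots>" .
  moreover have "V -` {..y} \<inter> space M = {\<omega> \<in> space M. V \<omega> \<le> y}" by auto
  ultimately show "dist_fun M V y = (\<integral>x. (if x \<le> y then enn2real (f x) else 0) \<partial>lborel)"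
    unfolding dist_fun_def measure_def by (simp add: Bochner_Integration.integral_nonneg)
qed

lemma (in prob_space) borel_measurable_dist_fun:
  fixes V :: "'a \<Rightarrow> real ^ 'd"
  assumes "continuous_rv M V"
  shows "dist_fun M V \<in> borel_measurable borel"
proof -
  obtain f where f: "distributed M lborel V f" using assms by (auto simp: continuous_rv_def)
  have [measurable]: "f \<in> borel_measurable borel"
    using distributed_borel_measurable[OF f] by simp
  show ?thesis unfolding dist_fun_eq_integral(3)[OF f] by measurable
qed

text \<open>Suppose both probabilities vanish for every \<open>\<eta>\<close>. Where
  \<open>D\<close> is nonzero, both densities are then zero almost everywhere; where
  \<open>D\<close> is zero, their difference is zero by \<open>AE_orthant_integral_zero\<close>.
  Hence \<open>D\<close> is the integral of a null function. A margin \<open>\<eta>\<close>, rather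
  than mere inequality, is what gives the detectors a uniform lower bound.\<close>

lemma (in prob_space) dist_fun_differ_with_positive_prob:
  fixes V W :: "'a \<Rightarrow> real ^ 'd"
  assumes V: "continuous_rv M V" and W: "continuous_rv M W"
    and ne: "dist_fun M V \<noteq> dist_fun M W"
  shows "\<exists>\<eta>>0. 0 < prob {\<omega> \<in> space M. \<eta> < \<bar>dist_fun M V (V \<omega>) - dist_fun M W (V \<omega>)\<bar>} +
    prob {\<omega> \<in> space M. \<eta> < \<bar>dist_fun M V (W \<omega>) - dist_fun M W (W \<omega>)\<bar>}"
proof (rule ccontr)
  assume contra: "\<not> ?thesis"
  define D where "D y = dist_fun M V y - dist_fun M W y" for y
  note [measurable] = borel_measurable_dist_fun[OF V] borel_measurable_dist_fun[OF W]
  have [measurable]: "D \<in> borel_measurable borel" unfolding D_def by measurable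
  obtain f where f: "distributed M lborel V f" using V by (auto simp: continuous_rv_def)
  obtain g where g: "distributed M lborel W g" using W by (auto simp: continuous_rv_def)
  have zero: "prob {\<omega> \<in> space M. \<eta> < \<bar>D (V \<omega>)\<bar>} = 0 \<and> prob {\<omega> \<in> space M. \<eta> < \<bar>D (W \<omega>)\<bar>} = 0" if "\<eta> > 0" for \<eta>
  proof -
    have "\<not> 0 < prob {\<omega> \<in> space M. \<eta> < \<bar>D (V \<omega>)\<bar>} + prob {\<omega> \<in> space M. \<eta> < \<bar>D (W \<omega>)\<bar>}"
      using contra that unfolding D_def by blast
    moreover have "0 \<le> prob {\<omega> \<in> space M. \<eta> < \<bar>D (V \<omega>)\<bar>}" "0 \<le> prob {\<omega> \<in> space M. \<eta> < \<bar>D (W \<omega>)\<bar>}" by auto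
    ultimately show ?thesis by linarith
  qed
  have ae: "AE x in lborel. f x \<noteq> 0 \<longrightarrow> D x = 0"
    if f: "distributed M lborel U f" and z: "\<And>\<eta>. \<eta> > 0 \<Longrightarrow> prob {\<omega> \<in> space M. \<eta> < \<bar>D (U \<omega>)\<bar>} = 0"
    for U and f :: "real ^ 'd \<Rightarrow> ennreal"
  proof -
    have [measurable]: "U \<in> borel_measurable M" using distributed_measurable[OF f] by simp
    have [measurable]: "f \<in> borel_measurable borel" using distributed_borel_measurable[OF f] by simp
    \<comment> \<open>The event that \<open>D (U \<omega>)\<close> is nonzero is exhausted by
      countably many of the null events.\<close>
    have "AE \<omega> in M. \<forall>n. \<bar>D (U \<omega>)\<bar> \<le> 1 / real (Suc n)"
    proof (subst AE_all_countable, rule allI)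
      fix n
      have "{\<omega> \<in> space M. 1 / real (Suc n) < \<bar>D (U \<omega>)\<bar>} \<in> null_sets M"
        by (intro null_setsI) (simp add: emeasure_eq_measure z, measurable)
      then have "AE \<omega> in M. \<omega> \<notin> {\<omega> \<in> space M. 1 / real (Suc n) < \<bar>D (U \<omega>)\<bar>}"
        by (rule AE_not_in)
      with AE_space show "AE \<omega> in M. \<bar>D (U \<omega>)\<bar> \<le> 1 / real (Suc n)"
        by eventually_elim auto
    qed
    then have "AE \<omega> in M. D (U \<omega>) = 0"
    proof eventually_elim
      case (elim \<omega>)
      have "\<bar>D (U \<omega>)\<bar> \<le> 0"
      proof (rule LIMSEQ_le_const)
        show "(\<lambda>n. 1 / real (Suc n)) \<longlonglongrightarrow> 0" by (rule LIMSEQ_Suc[OF lim_1_over_n])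
      qed (use elim in auto)
      then show ?case by simp
    qed
    then have "AE x in distr M lborel U. D x = 0"
      by (subst AE_distr_iff) auto
    then have "AE x in density lborel f. D x = 0"
      unfolding distributed_distr_eq_density[OF f] .
    then show ?thesis
      by (subst (asm) AE_density) (auto simp: zero_less_iff_neq_zero)
  qed
  define h where "h x = enn2real (f x) - enn2real (g x)" for x
  note Vint = dist_fun_eq_integral[OF f] and Wint = dist_fun_eq_integral[OF g]
  have h: "integrable lborel h" unfolding h_def using Vint(1) Wint(1) by simp
  have D_eq: "D y = (\<integral>x. (if x \<le> y then h x else 0) \<partial>lborel)" for y
  proof -
    have "D y = (\<integral>x. (if x \<le> y then enn2real (f x) else 0) - (if x \<le> y then enn2real (g x) else 0) \<partial>lborel)"
      unfolding D_def Vint(3) Wint(3)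
      by (rule Bochner_Integration.integral_diff[symmetric]; rule integrable_if) (use Vint Wint in auto)
    also have "\<dots> = (\<integral>x. (if x \<le> y then h x else 0) \<partial>lborel)"
      by (rule Bochner_Integration.integral_cong) (auto simp: h_def)
    finally show ?thesis .
  qed
  have "AE x in lborel. D x = 0 \<longrightarrow> h x = 0"
    unfolding D_eq by (rule AE_orthant_integral_zero[OF h])
  moreover have "AE x in lborel. f x \<noteq> 0 \<longrightarrow> D x = 0" "AE x in lborel. g x \<noteq> 0 \<longrightarrow> D x = 0"
    using ae[OF f] ae[OF g] zero by blast+
  ultimately have h0: "AE x in lborel. h x = 0"
    by eventually_elim (auto simp: h_def)
  have "D y = 0" for y
  proof -
    have [measurable]: "h \<in> borel_measurable borel" using borel_measurable_integrable[OF h] by simp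
    have "D y = (\<integral>x. 0 \<partial>(lborel :: (real ^ 'd) measure))"
      unfolding D_eq
    proof (rule integral_cong_AE)
      show "AE x in lborel. (if x \<le> y then h x else 0) = 0" using h0 by eventually_elim simp
    qed measurable
    then show ?thesis by simp
  qed
  then show False using ne by (auto simp: D_def fun_eq_iff)
qed

section \<open>Change-point processes and detectors\<close>

lemma mspace_linf:
  "f \<in> mspace (linf S) \<longleftrightarrow> f \<in> extensional S \<and> (\<exists>C. \<forall>z\<in>S. \<bar>f z\<bar> \<le> C)"
proof -
  have "Met_TC.mbounded (f ` S) \<longleftrightarrow> (\<exists>C. \<forall>z\<in>S. \<bar>f z\<bar> \<le> C)"
    by (simp add: mbounded_iff_bounded bounded_iff)
  then show ?thesis
    by (simp add: linf_def Met_TC.fspace_def)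
qed

lemma mdist_linf_le:
  assumes "f \<in> mspace (linf S)" "g \<in> mspace (linf S)" "S \<noteq> {}" "\<And>z. z \<in> S \<Longrightarrow> \<bar>f z - g z\<bar> \<le> \<epsilon>"
  shows "mdist (linf S) f g \<le> \<epsilon>"
  using assms unfolding linf_def mdist_funspace mspace_funspace
  by (auto simp: Met_TC.fdist_def dist_real_def intro!: cSUP_least)

lemma converges_in_prob_linfI:
  assumes "S \<noteq> {}" "\<And>m \<omega>. \<omega> \<in> space M \<Longrightarrow> \<exists>C. \<forall>z\<in>S. \<bar>W m \<omega> z\<bar> \<le> C" "\<exists>C. \<forall>z\<in>S. \<bar>w z\<bar> \<le> C"
    and "\<And>\<epsilon>. \<epsilon> > 0 \<Longrightarrow> whp M (\<lambda>m \<omega>. \<forall>z\<in>S. \<bar>W m \<omega> z - w z\<bar> \<le> \<epsilon>)"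
  shows "converges_in_prob M (linf S) (\<lambda>m \<omega>. restrict (W m \<omega>) S) (restrict w S)"
proof -
  have W: "restrict (W m \<omega>) S \<in> mspace (linf S)" if "\<omega> \<in> space M" for m \<omega>
    using assms(2)[OF that] by (simp add: mspace_linf)
  have w: "restrict w S \<in> mspace (linf S)"
    using assms(3) by (simp add: mspace_linf)
  have "whp M (\<lambda>m \<omega>. \<not> mdist (linf S) (restrict (W m \<omega>) S) (restrict w S) > \<epsilon>)" if "\<epsilon> > 0" for \<epsilon>
    using assms(4)[OF that]
    by (rule whp_mono) (auto intro!: always_eventually mdist_linf_le W w assms(1) simp: not_less)
  then show ?thesis unfolding converges_in_prob_def whp_def using W w by simp
qed

lemma diverges_in_probI:
  "(\<And>C. whp M (\<lambda>m \<omega>. C < W m \<omega>)) \<Longrightarrow> diverges_in_prob M W"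
  by (simp add: diverges_in_prob_def whp_def not_less)

text \<open>The threshold \<open>C'\<close> may be any function of \<open>C\<close>, so nonlinear
  comparisons such as that of \<open>S_det\<close> with the square of \<open>R_det\<close> are
  covered.\<close>

lemma diverges_in_prob_mono:
  assumes "diverges_in_prob M W" "\<And>C. \<exists>C'. \<forall>\<^sub>F m in sequentially. \<forall>\<omega>\<in>space M. C' < W m \<omega> \<longrightarrow> C < W' m \<omega>"
  shows "diverges_in_prob M W'"
proof (rule diverges_in_probI)
  fix C
  obtain C' where C': "\<forall>\<^sub>F m in sequentially. \<forall>\<omega>\<in>space M. C' < W m \<omega> \<longrightarrow> C < W' m \<omega>"
    using assms(2) by blast
  have "whp M (\<lambda>m \<omega>. C' < W m \<omega>)"
    using assms(1) by (simp add: diverges_in_prob_def whp_def not_less)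
  then show "whp M (\<lambda>m \<omega>. C < W' m \<omega>)" using C' by (rule whp_mono)
qed

section \<open>Algebra of the scaled process and of its limit\<close>

lemma lam_0: "lam m 0 s = of_int \<lfloor>real m * s\<rfloor> / real m"
  by (simp add: lam_def)

lemma lam_0_nat: "0 \<le> s \<Longrightarrow> lam m 0 s = real (nat \<lfloor>real m * s\<rfloor>) / real m"
  by (simp add: lam_0)

lemma lam_0_bounds:
  assumes "0 \<le> s"
  shows "0 \<le> lam m 0 s" "lam m 0 s \<le> s" "m > 0 \<Longrightarrow> \<bar>lam m 0 s - s\<bar> \<le> 1 / real m"
proof -
  show "0 \<le> lam m 0 s" using assms by (simp add: lam_0_nat)
  show *: "lam m 0 s \<le> s"
    using floor_div_bounds(1)[of m s] assms by (cases "m = 0") (auto simp: lam_0_nat)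
  show "m > 0 \<Longrightarrow> \<bar>lam m 0 s - s\<bar> \<le> 1 / real m"
    using floor_div_bounds(2)[of m s] assms * by (simp add: lam_0_nat)
qed

text \<open>Multiplication by the length removes the denominator. For \<open>j = k\<close> both
  sides vanish, so empty stretches need no separate treatment later.\<close>

lemma ecdf_mult_length:
  "(real k - real j) * ecdf x (j + 1) k y = (\<Sum>i = j + 1..k. of_bool (x i \<le> y))" if "j \<le> k"
  using that by (cases "j = k") (auto simp: ecdf_def)

lemma ecdf_bounds: "0 \<le> ecdf x j k y" "ecdf x j k y \<le> 1"
proof -
  show "0 \<le> ecdf x j k y" by (auto simp: ecdf_def intro!: divide_nonneg_nonneg sum_nonneg)
  have "(\<Sum>i = j..k. of_bool (x i \<le> y) :: real) \<le> real k - real j + 1" if "j \<le> k"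
  proof -
    have "(\<Sum>i = j..k. of_bool (x i \<le> y) :: real) \<le> (\<Sum>i = j..k. 1)" by (intro sum_mono) auto
    also have "\<dots> = real k - real j + 1" using that by (simp add: of_nat_diff Suc_diff_le)
    finally show ?thesis .
  qed
  then show "ecdf x j k y \<le> 1" by (auto simp: ecdf_def divide_le_eq_1)
qed

text \<open>With counts \<open>\<sigma> S\<close> and \<open>\<sigma> U\<close>, the weighted
  difference is \<open>(U - S) * \<sigma> S - S * (\<sigma> U - \<sigma> S)\<close>, where the mixed
  terms cancel and \<open>U * \<sigma> S - S * \<sigma> U\<close> is left. This is the form to which
  the uniform law applies.\<close>

lemma scaled_H_proc_eq_emp:
  assumes "0 \<le> s" "s \<le> t"
  shows "real m powr (- 1 / 2) * H_proc m x s t y = lam m 0 t * emp x m s {..y} - lam m 0 s * emp x m t {..y}"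
proof (cases "m = 0")
  case False
  define S U where "S = nat \<lfloor>real m * s\<rfloor>" and "U = nat \<lfloor>real m * t\<rfloor>"
  have SU: "S \<le> U" unfolding S_def U_def
    using assms by (intro nat_mono floor_mono mult_left_mono) auto
  define f where "f i = (of_bool (x i \<le> y) :: real)" for i
  define \<sigma> where "\<sigma> n = (\<Sum>i = 1..n. f i)" for n
  have lams: "lam m 0 s = real S / real m" "lam m 0 t = real U / real m" "lam m s t = (real U - real S) / real m"
    using assms by (simp_all add: lam_def S_def U_def)
  have emps: "emp x m s {..y} = \<sigma> S / real m" "emp x m t {..y} = \<sigma> U / real m"
    by (simp_all add: emp_def \<sigma>_def f_def S_def U_def)
  have e1: "real S * ecdf x 1 S y = \<sigma> S"
    using ecdf_mult_length[of 0 S x y] by (simp add: \<sigma>_def f_def)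
  have e2: "(real U - real S) * ecdf x (S + 1) U y = \<sigma> U - \<sigma> S"
  proof -
    have "\<sigma> U = \<sigma> S + (\<Sum>i = S + 1..U. f i)"
      unfolding \<sigma>_def using SU by (subst sum.union_disjoint[symmetric]) (auto intro!: sum.cong)
    then show ?thesis unfolding ecdf_mult_length[OF SU] f_def by simp
  qed
  have "real m powr (- 1 / 2) * sqrt (real m) = 1"
    using False by (simp add: powr_half_sqrt[symmetric] powr_add[symmetric])
  then have "real m powr (- 1 / 2) * H_proc m x s t y =
      lam m 0 s * lam m s t * (ecdf x 1 S y - ecdf x (S + 1) U y)"
    unfolding H_proc_def S_def U_def by (simp add: mult.assoc[symmetric])
  also have "\<dots> = real S * (real U - real S) * (ecdf x 1 S y - ecdf x (S + 1) U y) / (real m * real m)"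
    unfolding lams by simp
  also have "real S * (real U - real S) * (ecdf x 1 S y - ecdf x (S + 1) U y) =
      (real U - real S) * (real S * ecdf x 1 S y) - real S * ((real U - real S) * ecdf x (S + 1) U y)"
    by (simp add: algebra_simps)
  also have "\<dots> = (real U - real S) * \<sigma> S - real S * (\<sigma> U - \<sigma> S)"
    unfolding e1 e2 ..
  also have "((real U - real S) * \<sigma> S - real S * (\<sigma> U - \<sigma> S)) / (real m * real m) = (real U * \<sigma> S - real S * \<sigma> U) / (real m * real m)"
    by (simp add: algebra_simps)
  also have "\<dots> = lam m 0 t * emp x m s {..y} - lam m 0 s * emp x m t {..y}"
    unfolding lams emps by (simp add: diff_divide_distrib)
  finally show ?thesis .
qed (simp add: lam_def)

text \<open>Counts of \<open>v\<close> are taken from index 1 and subtracted up to the change, so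
  the weak law can be used without shifting the sequence. Before the change the two \<open>v\<close>
  terms cancel because \<open>max s c = c\<close>.\<close>

lemma emp_change_point:
  assumes u: "\<And>i. i \<in> {1..nat \<lfloor>real m * c\<rfloor>} \<Longrightarrow> x i = u i"
    and v: "\<And>i. i \<in> {nat \<lfloor>real m * c\<rfloor> + 1..nat \<lfloor>real m * L\<rfloor>} \<Longrightarrow> x i = v i"
    and s: "0 \<le> s" "s \<le> L"
  shows "emp x m s B = emp u m (min s c) B + emp v m (max s c) B - emp v m c B"
proof (cases "s \<le> c")
  case True
  then have "nat \<lfloor>real m * s\<rfloor> \<le> nat \<lfloor>real m * c\<rfloor>"
    by (intro nat_mono floor_mono mult_left_mono) auto
  then have "(\<Sum>i = 1..nat \<lfloor>real m * s\<rfloor>. of_bool (x i \<in> B) :: real) = (\<Sum>i = 1..nat \<lfloor>real m * s\<rfloor>. of_bool (u i \<in> B))"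
    using u by (intro sum.cong) auto
  with True show ?thesis by (simp add: emp_def)
next
  case False
  define S C where "S = nat \<lfloor>real m * s\<rfloor>" and "C = nat \<lfloor>real m * c\<rfloor>"
  have CS: "C \<le> S" "S \<le> nat \<lfloor>real m * L\<rfloor>" unfolding S_def C_def
    using False s by (auto intro!: nat_mono floor_mono mult_left_mono)
  have split: "(\<Sum>i = 1..S. f i) = (\<Sum>i = 1..C. f i) + (\<Sum>i = C + 1..S. f i)" for f :: "nat \<Rightarrow> real"
    using CS by (subst sum.union_disjoint[symmetric]) (auto intro!: sum.cong)
  have "(\<Sum>i = 1..S. of_bool (x i \<in> B) :: real) = (\<Sum>i = 1..C. of_bool (u i \<in> B)) + (\<Sum>i = C + 1..S. of_bool (v i \<in> B))"
    unfolding split using u v CS by (intro arg_cong2[where f="(+)"] sum.cong) (auto simp: C_def)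
  also have "(\<Sum>i = C + 1..S. of_bool (v i \<in> B) :: real) = (\<Sum>i = 1..S. of_bool (v i \<in> B)) - (\<Sum>i = 1..C. of_bool (v i \<in> B))"
    unfolding split by simp
  finally show ?thesis using False
    by (simp add: emp_def S_def C_def min_def max_def add_divide_distrib diff_divide_distrib)
qed

text \<open>This puts the limit into the two-term form of \<open>scaled_H_proc_eq_emp\<close>, so
  that the terms can be compared one by one.\<close>

lemma K_lim_eq:
  assumes "s \<le> t"
  shows "K_lim c F G s t y =
    t * (min s c * F y + (max s c - c) * G y) - s * (min t c * F y + (max t c - c) * G y)"
  using assms by (auto simp: K_lim_def min_def max_def algebra_simps)

lemma K_lim_bound:
  assumes "0 \<le> s" "s \<le> t" "t \<le> L" "0 \<le> c" "c \<le> L" "\<bar>F y - G y\<bar> \<le> 1"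
  shows "\<bar>K_lim c F G s t y\<bar> \<le> L * L"
proof -
  have "\<bar>K_lim c F G s t y\<bar> = \<bar>min s c\<bar> * \<bar>max t c - max s c\<bar> * \<bar>F y - G y\<bar>"
    by (simp add: K_lim_def abs_mult)
  also have "\<dots> \<le> L * L * 1"
    using assms by (intro mult_mono) auto
  finally show ?thesis by simp
qed

lemma scaled_H_proc_bound:
  assumes "0 \<le> s" "s \<le> t" "t \<le> L"
  shows "\<bar>real m powr (- 1 / 2) * H_proc m x s t y\<bar> \<le> L * L"
proof -
  have a: "0 \<le> lam m 0 t * emp x m s {..y}" "0 \<le> lam m 0 s * emp x m t {..y}"
    using assms by (auto intro!: mult_nonneg_nonneg lam_0_bounds emp_bounds)
  have "lam m 0 t * emp x m s {..y} \<le> L * L" "lam m 0 s * emp x m t {..y} \<le> L * L"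
    using assms lam_0_bounds[of t m] lam_0_bounds[of s m] emp_bounds[of s x m "{..y}"] emp_bounds[of t x m "{..y}"]
    by (auto intro!: mult_mono)
  with a show ?thesis unfolding scaled_H_proc_eq_emp[OF assms(1,2)] by linarith
qed

text \<open>The deterministic core. Three counts put an error \<open>3 * \<epsilon>\<close> on the
  observed count; each of the two products adds \<open>L * \<epsilon>\<close> for the rounding of
  time, hence \<open>4 * L * \<epsilon>\<close> twice.\<close>

lemma scaled_H_proc_close:
  assumes u: "\<And>i. i \<in> {1..nat \<lfloor>real m * c\<rfloor>} \<Longrightarrow> x i = u i"
    and v: "\<And>i. i \<in> {nat \<lfloor>real m * c\<rfloor> + 1..nat \<lfloor>real m * L\<rfloor>} \<Longrightarrow> x i = v i"
    and closeF: "\<And>s y. s \<in> {0..L} \<Longrightarrow> \<bar>emp u m s {..y} - s * F y\<bar> \<le> \<epsilon>"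
    and closeG: "\<And>s y. s \<in> {0..L} \<Longrightarrow> \<bar>emp v m s {..y} - s * G y\<bar> \<le> \<epsilon>"
    and m: "m > 0" "1 / real m \<le> \<epsilon>" and c: "0 \<le> c" "c \<le> L"
    and st: "0 \<le> s" "s \<le> t" "t \<le> L"
  shows "\<bar>real m powr (- 1 / 2) * H_proc m x s t y - K_lim c F G s t y\<bar> \<le> 8 * L * \<epsilon>"
proof -
  define U where "U r = min r c * F y + (max r c - c) * G y" for r
  have U: "\<bar>emp x m r {..y} - U r\<bar> \<le> 3 * \<epsilon>" if "0 \<le> r" "r \<le> L" for r
  proof -
    have "emp x m r {..y} = emp u m (min r c) {..y} + emp v m (max r c) {..y} - emp v m c {..y}"
      using that by (intro emp_change_point u v) auto
    then have "emp x m r {..y} - U r = (emp u m (min r c) {..y} - min r c * F y) +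
        (emp v m (max r c) {..y} - max r c * G y) - (emp v m c {..y} - c * G y)"
      by (simp add: U_def algebra_simps)
    moreover have "\<bar>emp u m (min r c) {..y} - min r c * F y\<bar> \<le> \<epsilon>" "\<bar>emp v m (max r c) {..y} - max r c * G y\<bar> \<le> \<epsilon>"
      "\<bar>emp v m c {..y} - c * G y\<bar> \<le> \<epsilon>"
      using that c by (auto intro!: closeF closeG)
    ultimately show ?thesis by linarith
  qed
  have term_close: "\<bar>lam m 0 r * emp x m r' {..y} - r * U r'\<bar> \<le> 4 * L * \<epsilon>" if r: "0 \<le> r" "r \<le> L" "0 \<le> r'" "r' \<le> L" for r r'
  proof -
    have "lam m 0 r * emp x m r' {..y} - r * U r' = (lam m 0 r - r) * emp x m r' {..y} + r * (emp x m r' {..y} - U r')"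
      by (simp add: algebra_simps)
    also have "\<bar>\<dots>\<bar> \<le> \<bar>lam m 0 r - r\<bar> * \<bar>emp x m r' {..y}\<bar> + \<bar>r\<bar> * \<bar>emp x m r' {..y} - U r'\<bar>"
      by (metis abs_mult abs_triangle_ineq)
    also have "\<dots> \<le> \<epsilon> * L + L * (3 * \<epsilon>)"
      using r lam_0_bounds(3)[of r m] m emp_bounds[of r' x m "{..y}"] U[of r']
      by (intro add_mono mult_mono) auto
    finally show ?thesis by (simp add: algebra_simps)
  qed
  have "real m powr (- 1 / 2) * H_proc m x s t y - K_lim c F G s t y =
      (lam m 0 t * emp x m s {..y} - t * U s) - (lam m 0 s * emp x m t {..y} - s * U t)"
    unfolding scaled_H_proc_eq_emp[OF st(1,2)] K_lim_eq[OF st(2)] U_def by simp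
  then show ?thesis using term_close[of t s] term_close[of s t] st by (simp add: abs_le_iff)
qed

section \<open>Continuity of the weight function\<close>

lemma qfun_ge: "\<delta> \<le> qfun \<gamma> \<delta> s t"
  by (simp add: qfun_def)

lemma compact_Delta: "compact (Delta T)"
proof -
  have "Delta T = ({0..T + 1} \<times> {0..T + 1}) \<inter> {z. fst z \<le> snd z}" by (auto simp: Delta_def)
  moreover have "closed {z::real \<times> real. fst z \<le> snd z}" by (intro closed_Collect_le continuous_intros)
  ultimately show ?thesis by (simp add: compact_Int_closed compact_Times)
qed

text \<open>For a positive exponent the powers extend continuously to zero; for
  \<open>\<gamma> = 0\<close> the case distinction in \<open>qfun\<close> makes the weight
  constant.\<close>

lemma continuous_on_qfun:
  assumes "0 \<le> \<gamma>"
  shows "continuous_on (Delta T) (\<lambda>z. qfun \<gamma> \<delta> (fst z) (snd z))"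
proof (cases "\<gamma> = 0")
  case False
  with assms show ?thesis
    unfolding qfun_def by (auto intro!: continuous_intros continuous_on_powr' simp: Delta_def)
qed (simp add: qfun_def)

text \<open>\<open>Hq_proc\<close> evaluates the weight at rounded times, the limit at exact ones.
  Compactness of the triangle makes this discrepancy uniformly small.\<close>

lemma qfun_uniformly_continuous:
  assumes "0 \<le> \<gamma>" "0 < \<epsilon>"
  shows "\<exists>\<rho>>0. \<forall>s t s' t'. (s, t) \<in> Delta T \<longrightarrow> (s', t') \<in> Delta T \<longrightarrow> \<bar>s - s'\<bar> < \<rho> \<longrightarrow> \<bar>t - t'\<bar> < \<rho> \<longrightarrow>
    \<bar>qfun \<gamma> \<delta> s t - qfun \<gamma> \<delta> s' t'\<bar> < \<epsilon>"
proof -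
  have "uniformly_continuous_on (Delta T) (\<lambda>z. qfun \<gamma> \<delta> (fst z) (snd z))"
    by (rule compact_uniformly_continuous[OF continuous_on_qfun[OF assms(1)] compact_Delta])
  then obtain \<rho> where \<rho>: "\<rho> > 0" "\<And>z z'. z \<in> Delta T \<Longrightarrow> z' \<in> Delta T \<Longrightarrow> dist z' z < \<rho> \<Longrightarrow>
      dist (qfun \<gamma> \<delta> (fst z') (snd z')) (qfun \<gamma> \<delta> (fst z) (snd z)) < \<epsilon>"
    using assms(2) unfolding uniformly_continuous_on_def by blast
  have "\<bar>qfun \<gamma> \<delta> s t - qfun \<gamma> \<delta> s' t'\<bar> < \<epsilon>"
    if "(s, t) \<in> Delta T" "(s', t') \<in> Delta T" "\<bar>s - s'\<bar> < \<rho> / 2" "\<bar>t - t'\<bar> < \<rho> / 2" for s t s' t'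
  proof -
    have "dist (s, t) (s', t') \<le> \<bar>s - s'\<bar> + \<bar>t - t'\<bar>"
      unfolding dist_prod_def by (simp add: dist_real_def sqrt_sum_squares_le_sum_abs)
    with that have "dist (s, t) (s', t') < \<rho>" by linarith
    from \<rho>(2)[OF that(2,1) this] show ?thesis by (simp add: dist_real_def)
  qed
  then show ?thesis using \<rho>(1) by (intro exI[of _ "\<rho> / 2"]) auto
qed

lemma qfun_bounded:
  assumes "0 \<le> \<gamma>"
  shows "\<exists>Q>0. \<forall>(s, t)\<in>Delta T. qfun \<gamma> \<delta> s t \<le> Q"
proof -
  have "bounded ((\<lambda>z. qfun \<gamma> \<delta> (fst z) (snd z)) ` Delta T)"
    by (intro compact_imp_bounded compact_continuous_image continuous_on_qfun compact_Delta assms)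
  then obtain Q where "Q > 0" "\<And>z. z \<in> Delta T \<Longrightarrow> \<bar>qfun \<gamma> \<delta> (fst z) (snd z)\<bar> \<le> Q"
    unfolding bounded_pos by auto
  then show ?thesis by (intro exI[of _ Q]) (auto simp: abs_le_iff)
qed

text \<open>Changing numerator and denominator in turn, with \<open>\<delta>\<close> bounding both
  denominators from below.\<close>

lemma Hq_proc_close:
  fixes h K q q' C :: real
  assumes H: "\<bar>h - K\<bar> \<le> \<epsilon>" and K: "\<bar>K\<bar> \<le> C" and q: "\<delta> \<le> q" "\<delta> \<le> q'" "0 < \<delta>" "\<bar>q' - q\<bar> \<le> \<epsilon>'"
  shows "\<bar>h / q' - K / q\<bar> \<le> \<epsilon> / \<delta> + C * \<epsilon>' / \<delta>\<^sup>2"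
proof -
  have pos: "0 < q" "0 < q'" using q by auto
  have "h / q' - K / q = (h - K) / q' + K * (q - q') / (q * q')"
    using pos by (simp add: field_simps)
  also have "\<bar>\<dots>\<bar> \<le> \<bar>(h - K) / q'\<bar> + \<bar>K * (q - q') / (q * q')\<bar>" by (rule abs_triangle_ineq)
  also have "\<bar>(h - K) / q'\<bar> \<le> \<epsilon> / \<delta>"
    using H q pos by (auto simp: abs_divide intro!: frac_le)
  also have "\<bar>K * (q - q') / (q * q')\<bar> \<le> C * \<epsilon>' / \<delta>\<^sup>2"
  proof -
    have "\<bar>K\<bar> * \<bar>q - q'\<bar> \<le> C * \<epsilon>'" using K q by (intro mult_mono) (auto simp: abs_minus_commute)
    moreover have "0 \<le> C * \<epsilon>'" using K q by (intro mult_nonneg_nonneg) linarith+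
    moreover have "\<delta>\<^sup>2 \<le> q * q'" using q by (auto simp: power2_eq_square intro!: mult_mono)
    ultimately show ?thesis using q pos by (auto simp: abs_divide abs_mult intro!: frac_le)
  qed
  finally show ?thesis by simp
qed

section \<open>Comparison of the detectors with the process and with each other\<close>

lemma det_weight_nonneg: "j \<le> k \<Longrightarrow> 0 < \<delta> \<Longrightarrow> 0 \<le> det_weight \<gamma> \<delta> m j k"
  using qfun_ge[of \<delta> \<gamma> "real j / real m" "real k / real m"]
  by (auto simp: det_weight_def intro!: divide_nonneg_nonneg mult_nonneg_nonneg)

text \<open>At \<open>s = j / m\<close> rounding is exact, so each term inside a detector is a value
  of the weighted process.\<close>

lemma det_weight_mult_ecdf_diff:
  assumes m: "m > 0" and t: "0 \<le> t" and j: "j \<le> nat \<lfloor>real m * t\<rfloor>"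
  shows "det_weight \<gamma> \<delta> m j (nat \<lfloor>real m * t\<rfloor>) * (ecdf x 1 j y - ecdf x (j + 1) (nat \<lfloor>real m * t\<rfloor>) y) =
    Hq_proc \<gamma> \<delta> m x (real j / real m) t y"
proof -
  define k where "k = nat \<lfloor>real m * t\<rfloor>"
  have lams: "lam m 0 (real j / real m) = real j / real m" "lam m 0 t = real k / real m"
    "lam m (real j / real m) t = (real k - real j) / real m"
    using m t by (simp_all add: lam_def k_def)
  have "real m powr (3 / 2) = real m powr (1 + 1 / 2)" by simp
  also have "\<dots> = real m * sqrt (real m)" using m by (simp only: powr_add powr_half_sqrt powr_one of_nat_0_le_iff)
  finally have "sqrt (real m) / (real m * real m) = 1 / real m powr (3 / 2)"
    using m by (simp add: field_simps)
  moreover have "sqrt (real m) * (real j / real m) * ((real k - real j) / real m) =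
      sqrt (real m) / (real m * real m) * (real j * (real k - real j))"
    by simp
  ultimately have eq: "sqrt (real m) * (real j / real m) * ((real k - real j) / real m) = real j * (real k - real j) / real m powr (3 / 2)"
    by simp
  have "nat \<lfloor>real m * (real j / real m)\<rfloor> = j" using m by simp
  then have "Hq_proc \<gamma> \<delta> m x (real j / real m) t y =
      sqrt (real m) * (real j / real m) * ((real k - real j) / real m) * (ecdf x 1 j y - ecdf x (j + 1) k y) /
      qfun \<gamma> \<delta> (real j / real m) (real k / real m)"
    by (simp add: Hq_proc_def H_proc_def lams k_def)
  then show ?thesis unfolding eq by (simp add: det_weight_def k_def)
qed

text \<open>Every observation is one of the points in the supremum, so each square is at most that
  of \<open>R_det\<close>; averages and maxima keep the bound. Nonnegativity of \<open>R_det\<close>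
  allows the square to be undone later.\<close>

lemma S_det_le_R_det_squared:
  assumes "m < k" "0 < \<delta>"
  shows "0 \<le> R_det \<gamma> \<delta> m x k" "S_det \<gamma> \<delta> m x k \<le> (R_det \<gamma> \<delta> m x k)\<^sup>2"
proof -
  define e where "e j y = \<bar>ecdf x 1 j y - ecdf x (j + 1) k y\<bar>" for j y
  have e: "0 \<le> e j y" "e j y \<le> 1" for j y
    using ecdf_bounds[of x 1 j y] ecdf_bounds[of x "j + 1" k y] by (auto simp: e_def)
  have bdd: "bdd_above (range (e j))" for j using e by (intro bdd_aboveI[of _ 1]) auto
  have R_eq: "R_det \<gamma> \<delta> m x k = (MAX j \<in> {m..k - 1}. det_weight \<gamma> \<delta> m j k * (SUP y. e j y))"
    using assms by (simp add: R_det_def e_def)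
  have R_ge: "det_weight \<gamma> \<delta> m j k * e j y \<le> R_det \<gamma> \<delta> m x k" if "j \<in> {m..k - 1}" for j y
  proof -
    have "det_weight \<gamma> \<delta> m j k * e j y \<le> det_weight \<gamma> \<delta> m j k * (SUP y. e j y)"
      using that assms by (intro mult_left_mono cSUP_upper bdd det_weight_nonneg) auto
    also have "\<dots> \<le> R_det \<gamma> \<delta> m x k"
      unfolding R_eq using that by (intro Max_ge) auto
    finally show ?thesis .
  qed
  have w: "0 \<le> det_weight \<gamma> \<delta> m j k" if "j \<in> {m..k - 1}" for j
    using that assms by (intro det_weight_nonneg) auto
  have "0 \<le> det_weight \<gamma> \<delta> m m k * e m 0" using assms e by (intro mult_nonneg_nonneg w) auto
  also have "\<dots> \<le> R_det \<gamma> \<delta> m x k" using assms by (intro R_ge) auto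
  finally show "0 \<le> R_det \<gamma> \<delta> m x k" .
  have "1 / real k * (\<Sum>i = 1..k. (det_weight \<gamma> \<delta> m j k * (ecdf x 1 j (x i) - ecdf x (j + 1) k (x i)))\<^sup>2)
      \<le> (R_det \<gamma> \<delta> m x k)\<^sup>2" if j: "j \<in> {m..k - 1}" for j
  proof -
    have "(det_weight \<gamma> \<delta> m j k * (ecdf x 1 j y - ecdf x (j + 1) k y))\<^sup>2 \<le> (R_det \<gamma> \<delta> m x k)\<^sup>2" for y
    proof -
      have "\<bar>det_weight \<gamma> \<delta> m j k * (ecdf x 1 j y - ecdf x (j + 1) k y)\<bar> \<le> R_det \<gamma> \<delta> m x k"
        using R_ge[OF j, of y] w[OF j] by (simp add: abs_mult e_def)
      then show ?thesis using power_mono[of "\<bar>_\<bar>" _ 2] by fastforce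
    qed
    then have "(\<Sum>i = 1..k. (det_weight \<gamma> \<delta> m j k * (ecdf x 1 j (x i) - ecdf x (j + 1) k (x i)))\<^sup>2)
        \<le> (\<Sum>i = 1..k. (R_det \<gamma> \<delta> m x k)\<^sup>2)"
      by (rule sum_mono)
    then show ?thesis using assms by (simp add: divide_le_eq mult.commute)
  qed
  then show "S_det \<gamma> \<delta> m x k \<le> (R_det \<gamma> \<delta> m x k)\<^sup>2"
    unfolding S_det_def using assms by (auto intro!: Max.boundedI)
qed

text \<open>\<open>T_det\<close> adds \<open>k - m\<close> averages, each at most their maximum
  \<open>S_det\<close>, and divides by \<open>m\<close>.\<close>

lemma T_det_le_S_det:
  assumes "0 < m" "m < k"
  shows "T_det \<gamma> \<delta> m x k \<le> (real k - real m) / real m * S_det \<gamma> \<delta> m x k"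
proof -
  define f where "f j = 1 / real k * (\<Sum>i = 1..k. (det_weight \<gamma> \<delta> m j k * (ecdf x 1 j (x i) - ecdf x (j + 1) k (x i)))\<^sup>2)" for j
  have "(\<Sum>j = m..k - 1. f j) \<le> (\<Sum>j = m..k - 1. S_det \<gamma> \<delta> m x k)"
    using assms unfolding S_det_def f_def by (intro sum_mono) (auto intro!: Max_ge)
  also have "\<dots> = (real k - real m) * S_det \<gamma> \<delta> m x k"
    using assms by (simp add: of_nat_diff Suc_diff_le)
  finally have "1 / real m * (\<Sum>j = m..k - 1. f j) \<le> 1 / real m * ((real k - real m) * S_det \<gamma> \<delta> m x k)"
    using assms by (intro mult_left_mono) auto
  then show ?thesis using assms by (simp add: T_det_def f_def)
qed

text \<open>The path takes only finitely many values, so its real supremum is a genuine upper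
  bound.\<close>

lemma SUP_det_proc_ge:
  assumes "1 \<le> L"
  shows "D (nat \<lfloor>real m * L\<rfloor>) \<le> (SUP t\<in>{1..L}. det_proc D m t)"
proof -
  have "det_proc D m ` {1..L} \<subseteq> D ` {..nat \<lfloor>real m * L\<rfloor>}"
    by (auto simp: det_proc_def intro!: imageI nat_mono floor_mono mult_left_mono)
  then have "finite (det_proc D m ` {1..L})" by (rule finite_subset) simp
  then have "bdd_above (det_proc D m ` {1..L})" by simp
  then have "det_proc D m L \<le> (SUP t\<in>{1..L}. det_proc D m t)"
    using assms by (intro cSUP_upper) auto
  then show ?thesis by (simp add: det_proc_def)
qed

text \<open>Only split points in \<open>J\<close> and observations in \<open>B\<close> are kept.
  Undoing the scaling makes each square at least \<open>real m * \<theta>\<^sup>2\<close>, and at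
  least a fraction \<open>\<rho> / L\<close> of the observations lies in \<open>B\<close>; the
  factor \<open>m\<close> cancels the one in \<open>T_det\<close>, so \<open>card J\<close>
  survives.\<close>

lemma T_det_lower_bound:
  assumes m: "0 < m" and L: "0 \<le> L"
    and J: "J \<subseteq> {m..nat \<lfloor>real m * L\<rfloor> - 1}" and mk: "m < nat \<lfloor>real m * L\<rfloor>"
    and \<theta>: "0 \<le> \<theta>" "\<And>j y. j \<in> J \<Longrightarrow> y \<in> B \<Longrightarrow> \<theta> \<le> \<bar>real m powr (- 1 / 2) * Hq_proc \<gamma> \<delta> m x (real j / real m) L y\<bar>"
    and \<rho>: "\<rho> \<le> emp x m L B"
  shows "real (card J) * (\<theta>\<^sup>2 * \<rho> / L) \<le> T_det \<gamma> \<delta> m x (nat \<lfloor>real m * L\<rfloor>)"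
proof -
  define k where "k = nat \<lfloor>real m * L\<rfloor>"
  define g where "g j i = (det_weight \<gamma> \<delta> m j k * (ecdf x 1 j (x i) - ecdf x (j + 1) k (x i)))\<^sup>2" for j i
  have k: "0 < real k" "real k \<le> real m * L"
    using mk floor_div_bounds(1)[OF m L] m by (auto simp: k_def divide_le_eq mult.commute)
  have g: "real m * \<theta>\<^sup>2 * of_bool (x i \<in> B) \<le> g j i" if j: "j \<in> J" for i j
  proof (cases "x i \<in> B")
    case True
    have "j \<in> {m..k - 1}" using j J unfolding k_def by blast
    then have "j \<le> k" by auto
    then have "det_weight \<gamma> \<delta> m j k * (ecdf x 1 j (x i) - ecdf x (j + 1) k (x i)) = Hq_proc \<gamma> \<delta> m x (real j / real m) L (x i)"
      unfolding k_def by (intro det_weight_mult_ecdf_diff m L)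
    moreover have "real m * \<theta>\<^sup>2 \<le> (Hq_proc \<gamma> \<delta> m x (real j / real m) L (x i))\<^sup>2"
    proof -
      have "(real m powr (- 1 / 2))\<^sup>2 = 1 / real m" (is "?p\<^sup>2 = _")
        using m by (simp add: power2_eq_square powr_add[symmetric] powr_minus_divide)
      then have "(?p * h)\<^sup>2 = h\<^sup>2 / real m" for h by (simp only: power_mult_distrib) simp
      moreover have "\<theta>\<^sup>2 \<le> (?p * Hq_proc \<gamma> \<delta> m x (real j / real m) L (x i))\<^sup>2"
        using power_mono[OF \<theta>(2)[OF j True] \<theta>(1), of 2] unfolding power2_abs .
      ultimately show ?thesis using m by (simp only: pos_le_divide_eq of_nat_0_less_iff) (simp add: mult.commute)
    qed
    ultimately show ?thesis using True by (simp add: g_def)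
  qed (simp add: g_def)
  have avg: "\<theta>\<^sup>2 * \<rho> / L * real m \<le> 1 / real k * (\<Sum>i = 1..k. g j i)" if "j \<in> J" for j
  proof -
    have "\<theta>\<^sup>2 * \<rho> / L * real m \<le> \<theta>\<^sup>2 * emp x m L B / L * real m"
      using L m \<rho> by (intro mult_right_mono divide_right_mono mult_left_mono) auto
    also have "\<dots> \<le> \<theta>\<^sup>2 * emp x m L B * real m * real m / real k"
    proof -
      have "\<theta>\<^sup>2 * emp x m L B * real m * (1 / L) \<le> \<theta>\<^sup>2 * emp x m L B * real m * (real m / real k)"
      proof (rule mult_left_mono)
        show "1 / L \<le> real m / real k"
        proof (cases "L = 0")
          case False
          then show ?thesis using k L by (simp add: field_simps)
        qed simp
      qed (intro mult_nonneg_nonneg emp_bounds L zero_le_power2 of_nat_0_le_iff)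
      then show ?thesis by (simp add: mult.assoc)
    qed
    also have "\<dots> = 1 / real k * (\<Sum>i = 1..k. real m * \<theta>\<^sup>2 * of_bool (x i \<in> B))"
      using m by (simp add: emp_def k_def[symmetric] sum_distrib_left[symmetric])
    also have "\<dots> \<le> 1 / real k * (\<Sum>i = 1..k. g j i)"
      using g[OF that] by (intro mult_left_mono sum_mono) auto
    finally show ?thesis .
  qed
  have "real (card J) * (\<theta>\<^sup>2 * \<rho> / L) = 1 / real m * (\<Sum>j\<in>J. \<theta>\<^sup>2 * \<rho> / L * real m)"
    using m by simp
  also have "\<dots> \<le> 1 / real m * (\<Sum>j\<in>J. 1 / real k * (\<Sum>i = 1..k. g j i))"
    using avg by (intro mult_left_mono sum_mono) auto
  also have "\<dots> \<le> 1 / real m * (\<Sum>j = m..k - 1. 1 / real k * (\<Sum>i = 1..k. g j i))"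
    using J by (intro mult_left_mono sum_mono2) (auto simp: k_def g_def intro!: divide_nonneg_nonneg sum_nonneg)
  also have "\<dots> = T_det \<gamma> \<delta> m x k"
    using mk by (simp add: T_det_def k_def g_def)
  finally show ?thesis by (simp add: k_def)
qed

section \<open>Uniform convergence in the change-point model\<close>

locale change_point = Y: mixing_seq M Y a + Z: mixing_seq M Z b
  for M :: "'a measure" and Y Z :: "int \<Rightarrow> 'a \<Rightarrow> real ^ 'd" and a b :: real +
  fixes X :: "nat \<Rightarrow> nat \<Rightarrow> 'a \<Rightarrow> real ^ 'd" and F G :: "real ^ 'd \<Rightarrow> real" and T c \<gamma> \<delta> :: real
  assumes c: "1 \<le> c" "c < T + 1" and \<delta>: "0 < \<delta>" and \<gamma>: "0 \<le> \<gamma>"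
    and contY: "continuous_rv M (Y 0)" and F: "F = dist_fun M (Y 0)"
    and contZ: "continuous_rv M (Z 0)" and G: "G = dist_fun M (Z 0)"
    and FG: "G \<noteq> F"
    and XY: "\<And>m i \<omega>. \<omega> \<in> space M \<Longrightarrow> i \<in> {1..nat \<lfloor>real m * c\<rfloor>} \<Longrightarrow> X m i \<omega> = Y (int i) \<omega>"
    and XZ: "\<And>m i \<omega>. \<omega> \<in> space M \<Longrightarrow> i \<in> {nat \<lfloor>real m * c\<rfloor> + 1..nat \<lfloor>real m * (T + 1)\<rfloor>} \<Longrightarrow>
      X m i \<omega> = Z (int i) \<omega>"
begin

lemma FG_le_1: "\<bar>F y - G y\<bar> \<le> 1"
proof -
  have "0 \<le> F y" "F y \<le> 1" "0 \<le> G y" "G y \<le> 1" unfolding F G dist_fun_def by auto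
  then show ?thesis by linarith
qed

lemma K_bound: "(s, t) \<in> Delta T \<Longrightarrow> \<bar>K_lim c F G s t y\<bar> \<le> (T + 1) * (T + 1)"
  using c FG_le_1 by (intro K_lim_bound) (auto simp: Delta_def)

lemma H_uniform:
  assumes "\<epsilon> > 0"
  shows "whp M (\<lambda>m \<omega>. \<forall>s t y. (s, t) \<in> Delta T \<longrightarrow>
    \<bar>real m powr (- 1 / 2) * H_proc m (\<lambda>i. X m i \<omega>) s t y - K_lim c F G s t y\<bar> \<le> \<epsilon>)"
proof -
  \<comment> \<open>Chosen to undo the constant \<open>8 * L\<close> of
    \<open>scaled_H_proc_close\<close> with \<open>L = T + 1\<close>.\<close>
  define \<epsilon>' where "\<epsilon>' = \<epsilon> / (8 * (T + 1))"
  have \<epsilon>': "0 < \<epsilon>'" "8 * (T + 1) * \<epsilon>' = \<epsilon>" using assms c by (auto simp: \<epsilon>'_def)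
  have "whp M (\<lambda>m \<omega>. (\<forall>s\<in>{0..T + 1}. \<forall>y. \<bar>emp (\<lambda>i. Y (int i) \<omega>) m s {..y} - s * F y\<bar> \<le> \<epsilon>') \<and>
      (\<forall>s\<in>{0..T + 1}. \<forall>y. \<bar>emp (\<lambda>i. Z (int i) \<omega>) m s {..y} - s * G y\<bar> \<le> \<epsilon>'))"
    unfolding F G using c \<epsilon>' by (intro whp_conj Y.uniform_weak_law Z.uniform_weak_law contY contZ) auto
  then show ?thesis
  proof (rule whp_mono)
    have "\<forall>\<^sub>F m in sequentially. 1 / real m < \<epsilon>'"
      using order_tendstoD(2)[OF lim_1_over_n \<epsilon>'(1)] .
    then show "\<forall>\<^sub>F m in sequentially. \<forall>\<omega>\<in>space M.
      (\<forall>s\<in>{0..T + 1}. \<forall>y. \<bar>emp (\<lambda>i. Y (int i) \<omega>) m s {..y} - s * F y\<bar> \<le> \<epsilon>') \<and>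
      (\<forall>s\<in>{0..T + 1}. \<forall>y. \<bar>emp (\<lambda>i. Z (int i) \<omega>) m s {..y} - s * G y\<bar> \<le> \<epsilon>') \<longrightarrow>
      (\<forall>s t y. (s, t) \<in> Delta T \<longrightarrow> \<bar>real m powr (- 1 / 2) * H_proc m (\<lambda>i. X m i \<omega>) s t y - K_lim c F G s t y\<bar> \<le> \<epsilon>)"
      using eventually_gt_at_top[of 0]
    proof (eventually_elim, intro ballI impI allI, elim conjE)
      fix m \<omega> s t y
      assume m: "1 / real m < \<epsilon>'" "0 < m" and \<omega>: "\<omega> \<in> space M" and st: "(s, t) \<in> Delta T"
        and "\<forall>s\<in>{0..T + 1}. \<forall>y. \<bar>emp (\<lambda>i. Y (int i) \<omega>) m s {..y} - s * F y\<bar> \<le> \<epsilon>'"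
        and "\<forall>s\<in>{0..T + 1}. \<forall>y. \<bar>emp (\<lambda>i. Z (int i) \<omega>) m s {..y} - s * G y\<bar> \<le> \<epsilon>'"
      then show "\<bar>real m powr (- 1 / 2) * H_proc m (\<lambda>i. X m i \<omega>) s t y - K_lim c F G s t y\<bar> \<le> \<epsilon>"
        unfolding \<epsilon>'(2)[symmetric]
        using c XY[OF \<omega>] XZ[OF \<omega>]
        by (intro scaled_H_proc_close[where u = "\<lambda>i. Y (int i) \<omega>" and v = "\<lambda>i. Z (int i) \<omega>"])
           (auto simp: Delta_def)
    qed
  qed
qed

lemma Hq_uniform:
  assumes "\<epsilon> > 0"
  shows "whp M (\<lambda>m \<omega>. \<forall>s t y. (s, t) \<in> Delta T \<longrightarrow>
    \<bar>real m powr (- 1 / 2) * Hq_proc \<gamma> \<delta> m (\<lambda>i. X m i \<omega>) s t y - Kq_lim \<gamma> \<delta> c F G s t y\<bar> \<le> \<epsilon>)"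
proof -
  \<comment> \<open>Each of the two error terms in \<open>Hq_proc_close\<close> becomes
    \<open>\<epsilon> / 2\<close>; the bound on the limit enters as the square of
    \<open>T + 1\<close>.\<close>
  define \<epsilon>1 where "\<epsilon>1 = \<epsilon> * \<delta> / 2"
  define \<epsilon>2 where "\<epsilon>2 = \<epsilon> * \<delta>\<^sup>2 / (2 * ((T + 1) * (T + 1)))"
  have T: "0 < T + 1" using c by linarith
  have \<epsilon>s: "0 < \<epsilon>1" "0 < \<epsilon>2" "\<epsilon>1 / \<delta> + (T + 1) * (T + 1) * \<epsilon>2 / \<delta>\<^sup>2 = \<epsilon>"
    using assms \<delta> T by (auto simp: \<epsilon>1_def \<epsilon>2_def)
  obtain \<rho> where \<rho>: "\<rho> > 0" "\<And>s t s' t'. (s, t) \<in> Delta T \<Longrightarrow> (s', t') \<in> Delta T \<Longrightarrow> \<bar>s - s'\<bar> < \<rho> \<Longrightarrow> \<bar>t - t'\<bar> < \<rho> \<Longrightarrow>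
      \<bar>qfun \<gamma> \<delta> s t - qfun \<gamma> \<delta> s' t'\<bar> < \<epsilon>2"
    using qfun_uniformly_continuous[OF \<gamma> \<epsilon>s(2), of T \<delta>] by blast
  show ?thesis
  proof (rule whp_mono[OF H_uniform[OF \<epsilon>s(1)]])
    have "\<forall>\<^sub>F m in sequentially. 1 / real m < \<rho>"
      using order_tendstoD(2)[OF lim_1_over_n \<rho>(1)] .
    then show "\<forall>\<^sub>F m in sequentially. \<forall>\<omega>\<in>space M.
      (\<forall>s t y. (s, t) \<in> Delta T \<longrightarrow> \<bar>real m powr (- 1 / 2) * H_proc m (\<lambda>i. X m i \<omega>) s t y - K_lim c F G s t y\<bar> \<le> \<epsilon>1) \<longrightarrow>
      (\<forall>s t y. (s, t) \<in> Delta T \<longrightarrow> \<bar>real m powr (- 1 / 2) * Hq_proc \<gamma> \<delta> m (\<lambda>i. X m i \<omega>) s t y - Kq_lim \<gamma> \<delta> c F G s t y\<bar> \<le> \<epsilon>)"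
      using eventually_gt_at_top[of 0]
    proof (eventually_elim, intro ballI impI allI)
      fix m \<omega> s t y
      assume m: "1 / real m < \<rho>" "0 < m" and st: "(s, t) \<in> Delta T"
        and close: "\<forall>s t y. (s, t) \<in> Delta T \<longrightarrow> \<bar>real m powr (- 1 / 2) * H_proc m (\<lambda>i. X m i \<omega>) s t y - K_lim c F G s t y\<bar> \<le> \<epsilon>1"
      have st': "0 \<le> s" "s \<le> t" "t \<le> T + 1" using st by (auto simp: Delta_def)
      have "lam m 0 s \<le> lam m 0 t"
        unfolding lam_0 using st' by (intro divide_right_mono) (auto intro!: floor_mono mult_left_mono)
      then have lams: "(lam m 0 s, lam m 0 t) \<in> Delta T"
        using lam_0_bounds[of s m] lam_0_bounds[of t m] st' by (auto simp: Delta_def)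
      have "\<bar>qfun \<gamma> \<delta> (lam m 0 s) (lam m 0 t) - qfun \<gamma> \<delta> s t\<bar> < \<epsilon>2"
        using lam_0_bounds(3)[of s m] lam_0_bounds(3)[of t m] st' m by (intro \<rho>(2) lams st) auto
      then have "\<bar>(real m powr (- 1 / 2) * H_proc m (\<lambda>i. X m i \<omega>) s t y) / qfun \<gamma> \<delta> (lam m 0 s) (lam m 0 t) - K_lim c F G s t y / qfun \<gamma> \<delta> s t\<bar>
          \<le> \<epsilon>1 / \<delta> + (T + 1) * (T + 1) * \<epsilon>2 / \<delta>\<^sup>2"
        using close st by (intro Hq_proc_close K_bound qfun_ge \<delta>) auto
      then show "\<bar>real m powr (- 1 / 2) * Hq_proc \<gamma> \<delta> m (\<lambda>i. X m i \<omega>) s t y - Kq_lim \<gamma> \<delta> c F G s t y\<bar> \<le> \<epsilon>"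
        unfolding \<epsilon>s(3) Hq_proc_def Kq_lim_def times_divide_eq_right .
    qed
  qed
qed

lemma Delta_nonempty: "Delta T \<times> (UNIV :: (real ^ 'd) set) \<noteq> {}"
proof -
  have "(0, 0) \<in> Delta T" using c by (simp add: Delta_def)
  then show ?thesis by blast
qed

lemma H_converges:
  "converges_in_prob M (linf (Delta T \<times> UNIV))
     (\<lambda>m \<omega>. restrict_Delta T (\<lambda>s t y. real m powr (- 1 / 2) * H_proc m (\<lambda>i. X m i \<omega>) s t y))
     (restrict_Delta T (K_lim c F G))"
  unfolding restrict_Delta_def
proof (rule converges_in_prob_linfI[OF Delta_nonempty])
  show "\<exists>C. \<forall>z\<in>Delta T \<times> UNIV. \<bar>(\<lambda>((s, t), y). real m powr (- 1 / 2) * H_proc m (\<lambda>i. X m i \<omega>) s t y) z\<bar> \<le> C" for m \<omega>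
    using scaled_H_proc_bound[of _ _ "T + 1" m "\<lambda>i. X m i \<omega>"]
    by (intro exI[of _ "(T + 1) * (T + 1)"]) (auto simp: Delta_def)
  show "\<exists>C. \<forall>z\<in>Delta T \<times> UNIV. \<bar>(\<lambda>((s, t), y). K_lim c F G s t y) z\<bar> \<le> C"
    using K_bound by (intro exI[of _ "(T + 1) * (T + 1)"]) auto
  show "whp M (\<lambda>m \<omega>. \<forall>z\<in>Delta T \<times> UNIV.
      \<bar>(\<lambda>((s, t), y). real m powr (- 1 / 2) * H_proc m (\<lambda>i. X m i \<omega>) s t y) z - (\<lambda>((s, t), y). K_lim c F G s t y) z\<bar> \<le> \<epsilon>)"
    if "0 < \<epsilon>" for \<epsilon>
    using H_uniform[OF that] by (rule whp_mono) (auto intro!: always_eventually)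
qed

lemma Hq_converges:
  "converges_in_prob M (linf (Delta T \<times> UNIV))
     (\<lambda>m \<omega>. restrict_Delta T (\<lambda>s t y. real m powr (- 1 / 2) * Hq_proc \<gamma> \<delta> m (\<lambda>i. X m i \<omega>) s t y))
     (restrict_Delta T (Kq_lim \<gamma> \<delta> c F G))"
  unfolding restrict_Delta_def
proof (rule converges_in_prob_linfI[OF Delta_nonempty])
  have div: "\<bar>h / qfun \<gamma> \<delta> s' t'\<bar> \<le> (T + 1) * (T + 1) / \<delta>" if "\<bar>h\<bar> \<le> (T + 1) * (T + 1)" for h s' t'
    using that qfun_ge[of \<delta> \<gamma> s' t'] \<delta> by (auto simp: abs_divide intro!: frac_le)
  show "\<exists>C. \<forall>z\<in>Delta T \<times> UNIV. \<bar>(\<lambda>((s, t), y). real m powr (- 1 / 2) * Hq_proc \<gamma> \<delta> m (\<lambda>i. X m i \<omega>) s t y) z\<bar> \<le> C" for m \<omega>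
  proof (intro exI ballI)
    fix z assume "z \<in> Delta T \<times> (UNIV :: (real ^ 'd) set)"
    then obtain s t y where z: "z = ((s, t), y)" "0 \<le> s" "s \<le> t" "t \<le> T + 1" by (auto simp: Delta_def)
    show "\<bar>(\<lambda>((s, t), y). real m powr (- 1 / 2) * Hq_proc \<gamma> \<delta> m (\<lambda>i. X m i \<omega>) s t y) z\<bar> \<le> (T + 1) * (T + 1) / \<delta>"
      unfolding z(1) prod.case Hq_proc_def times_divide_eq_right
      by (intro div scaled_H_proc_bound z)
  qed
  show "\<exists>C. \<forall>z\<in>Delta T \<times> UNIV. \<bar>(\<lambda>((s, t), y). Kq_lim \<gamma> \<delta> c F G s t y) z\<bar> \<le> C"
  proof (intro exI ballI)
    fix z assume "z \<in> Delta T \<times> (UNIV :: (real ^ 'd) set)"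
    then obtain s t y where z: "z = ((s, t), y)" "(s, t) \<in> Delta T" by auto
    show "\<bar>(\<lambda>((s, t), y). Kq_lim \<gamma> \<delta> c F G s t y) z\<bar> \<le> (T + 1) * (T + 1) / \<delta>"
      unfolding z(1) prod.case Kq_lim_def by (intro div K_bound z)
  qed
  show "whp M (\<lambda>m \<omega>. \<forall>z\<in>Delta T \<times> UNIV.
      \<bar>(\<lambda>((s, t), y). real m powr (- 1 / 2) * Hq_proc \<gamma> \<delta> m (\<lambda>i. X m i \<omega>) s t y) z - (\<lambda>((s, t), y). Kq_lim \<gamma> \<delta> c F G s t y) z\<bar> \<le> \<epsilon>)"
    if "0 < \<epsilon>" for \<epsilon>
    using Hq_uniform[OF that] by (rule whp_mono) (auto intro!: always_eventually)
qed

section \<open>Divergence of the detectors\<close>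

lemma observations_separating:
  "\<exists>\<eta>>0. \<exists>\<rho>>0. whp M (\<lambda>m \<omega>. \<rho> \<le> emp (\<lambda>i. X m i \<omega>) m (T + 1) {y. \<eta> < \<bar>F y - G y\<bar>})"
proof -
  have "dist_fun M (Y 0) \<noteq> dist_fun M (Z 0)" using FG by (simp add: F G)
  from Y.dist_fun_differ_with_positive_prob[OF contY contZ this, folded F G]
  obtain \<eta> where \<eta>: "\<eta> > 0" "0 < Y.prob {\<omega> \<in> space M. \<eta> < \<bar>F (Y 0 \<omega>) - G (Y 0 \<omega>)\<bar>} +
      Y.prob {\<omega> \<in> space M. \<eta> < \<bar>F (Z 0 \<omega>) - G (Z 0 \<omega>)\<bar>}"
    by (elim exE conjE)
  define B where "B = {y. \<eta> < \<bar>F y - G y\<bar>}"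
  have [measurable]: "F \<in> borel_measurable borel" "G \<in> borel_measurable borel"
    unfolding F G using Y.borel_measurable_dist_fun contY contZ by auto
  have "{y \<in> space borel. \<eta> < \<bar>F y - G y\<bar>} \<in> sets borel" by measurable
  then have B: "B \<in> sets borel" by (simp add: B_def)
  define p p' where "p = Y.prob {\<omega> \<in> space M. Y 0 \<omega> \<in> B}" and "p' = Y.prob {\<omega> \<in> space M. Z 0 \<omega> \<in> B}"
  \<comment> \<open>The normalised count tends to \<open>4 * \<rho>\<close>, and three errors of
    size \<open>\<rho>\<close> leave \<open>\<rho>\<close>. It is positive whichever of the two laws
    charges \<open>B\<close>, since both regimes last for a positive time.\<close>
  define \<rho> where "\<rho> = (c * p + (T + 1 - c) * p') / 4"
  have pp: "0 \<le> p" "0 \<le> p'" "0 < p + p'" using \<eta>(2) by (auto simp: p_def p'_def B_def)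
  have \<rho>: "0 < \<rho>"
  proof (cases "p = 0")
    case True
    then show ?thesis using pp c by (simp add: \<rho>_def)
  next
    case False
    then have "0 < c * p" "0 \<le> (T + 1 - c) * p'" using pp c by auto
    then show ?thesis by (simp add: \<rho>_def)
  qed
  have "whp M (\<lambda>m \<omega>. \<bar>emp (\<lambda>i. Y (int i) \<omega>) m c B - c * p\<bar> \<le> \<rho> \<and>
      \<bar>emp (\<lambda>i. Z (int i) \<omega>) m (T + 1) B - (T + 1) * p'\<bar> \<le> \<rho> \<and> \<bar>emp (\<lambda>i. Z (int i) \<omega>) m c B - c * p'\<bar> \<le> \<rho>)"
    unfolding p_def p'_def using c \<rho> by (intro whp_conj Y.weak_law Z.weak_law B) auto
  then have "whp M (\<lambda>m \<omega>. \<rho> \<le> emp (\<lambda>i. X m i \<omega>) m (T + 1) B)"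
  proof (rule whp_mono, intro always_eventually allI ballI impI, elim conjE)
    fix m \<omega> assume \<omega>: "\<omega> \<in> space M"
      and cl: "\<bar>emp (\<lambda>i. Y (int i) \<omega>) m c B - c * p\<bar> \<le> \<rho>"
        "\<bar>emp (\<lambda>i. Z (int i) \<omega>) m (T + 1) B - (T + 1) * p'\<bar> \<le> \<rho>" "\<bar>emp (\<lambda>i. Z (int i) \<omega>) m c B - c * p'\<bar> \<le> \<rho>"
    have "emp (\<lambda>i. X m i \<omega>) m (T + 1) B = emp (\<lambda>i. Y (int i) \<omega>) m (min (T + 1) c) B +
        emp (\<lambda>i. Z (int i) \<omega>) m (max (T + 1) c) B - emp (\<lambda>i. Z (int i) \<omega>) m c B"
      by (rule emp_change_point[OF XY[OF \<omega>] XZ[OF \<omega>]]) (use c in auto)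
    moreover have "4 * \<rho> = c * p + (T + 1 - c) * p'" by (simp add: \<rho>_def)
    then have "4 * \<rho> = c * p + (T + 1) * p' - c * p'" by (simp add: algebra_simps)
    ultimately show "\<rho> \<le> emp (\<lambda>i. X m i \<omega>) m (T + 1) B" using cl c by simp
  qed
  then show ?thesis using \<eta>(1) \<rho> unfolding B_def by blast
qed

text \<open>A single split point has vanishing weight in \<open>T_det\<close>, so an interval of
  them is used, on which the limit process stays away from zero at all points with
  \<open>\<eta> < \<bar>F y - G y\<bar>\<close>.\<close>

lemma T_det_diverges: "diverges_in_prob M (\<lambda>m \<omega>. T_det \<gamma> \<delta> m (\<lambda>i. X m i \<omega>) (nat \<lfloor>real m * (T + 1)\<rfloor>))"
proof (rule diverges_in_probI)
  fix C
  obtain \<eta> \<rho> where \<eta>: "0 < \<eta>" and \<rho>: "0 < \<rho>"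
    and sep: "whp M (\<lambda>m \<omega>. \<rho> \<le> emp (\<lambda>i. X m i \<omega>) m (T + 1) {y. \<eta> < \<bar>F y - G y\<bar>})"
    using observations_separating by blast
  obtain Q where Q: "0 < Q" "\<And>s t. (s, t) \<in> Delta T \<Longrightarrow> qfun \<gamma> \<delta> s t \<le> Q"
    using qfun_bounded[OF \<gamma>, of T \<delta>] by blast
  \<comment> \<open>For split times after the change the limit has the factor
    \<open>T + 1 - s\<close>; stopping halfway keeps it bounded below.\<close>
  define c' where "c' = (c + T + 1) / 2"
  have c': "c < c'" "c' < T + 1" using c by (auto simp: c'_def)
  \<comment> \<open>Half of the lower bound for the limit, so that an approximation error
    \<open>\<theta>\<close> leaves \<open>\<theta>\<close>.\<close>
  define \<theta> where "\<theta> = c * (T + 1 - c') * \<eta> / Q / 2"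
  have \<theta>: "0 < \<theta>" using c c' \<eta> Q by (simp add: \<theta>_def)
  define C0 where "C0 = \<theta>\<^sup>2 * \<rho> / (T + 1)"
  have C0: "0 < C0" using \<theta> \<rho> c by (simp add: C0_def)
  have Kq: "2 * \<theta> \<le> \<bar>Kq_lim \<gamma> \<delta> c F G s (T + 1) y\<bar>" if s: "c \<le> s" "s \<le> c'" and y: "\<eta> < \<bar>F y - G y\<bar>" for s y
  proof -
    have st: "(s, T + 1) \<in> Delta T" using s c c' by (auto simp: Delta_def)
    have "\<bar>K_lim c F G s (T + 1) y\<bar> = c * (T + 1 - s) * \<bar>F y - G y\<bar>"
      using s c c' by (simp add: K_lim_def abs_mult)
    moreover have "c * (T + 1 - c') * \<eta> \<le> c * (T + 1 - s) * \<bar>F y - G y\<bar>"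
      using s c c' y \<eta> by (intro mult_mono) auto
    moreover have "0 < qfun \<gamma> \<delta> s (T + 1)" using qfun_ge[of \<delta> \<gamma> s "T + 1"] \<delta> by linarith
    ultimately show ?thesis
      using Q(2)[OF st] by (auto simp: \<theta>_def Kq_lim_def abs_divide intro!: frac_le)
  qed
  show "whp M (\<lambda>m \<omega>. C < T_det \<gamma> \<delta> m (\<lambda>i. X m i \<omega>) (nat \<lfloor>real m * (T + 1)\<rfloor>))"
  proof (rule whp_mono[OF whp_conj[OF Hq_uniform[OF \<theta>] sep]])
    have large: "\<forall>\<^sub>F m in sequentially. r < real m" for r
      using filterlim_real_sequentially unfolding filterlim_at_top_dense by blast
    show "\<forall>\<^sub>F m in sequentially. \<forall>\<omega>\<in>space M.
      (\<forall>s t y. (s, t) \<in> Delta T \<longrightarrow> \<bar>real m powr (- 1 / 2) * Hq_proc \<gamma> \<delta> m (\<lambda>i. X m i \<omega>) s t y - Kq_lim \<gamma> \<delta> c F G s t y\<bar> \<le> \<theta>) \<and>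
      \<rho> \<le> emp (\<lambda>i. X m i \<omega>) m (T + 1) {y. \<eta> < \<bar>F y - G y\<bar>} \<longrightarrow>
      C < T_det \<gamma> \<delta> m (\<lambda>i. X m i \<omega>) (nat \<lfloor>real m * (T + 1)\<rfloor>)"
      using large[of "1 / (T + 1 - c')"] large[of "(C / C0 + 2) / (c' - c)"] large[of 0]
    proof (eventually_elim, intro ballI impI, elim conjE)
      fix m \<omega>
      assume m: "1 / (T + 1 - c') < real m" "(C / C0 + 2) / (c' - c) < real m" "0 < real m"
        and \<omega>: "\<omega> \<in> space M"
        and close: "\<forall>s t y. (s, t) \<in> Delta T \<longrightarrow> \<bar>real m powr (- 1 / 2) * Hq_proc \<gamma> \<delta> m (\<lambda>i. X m i \<omega>) s t y - Kq_lim \<gamma> \<delta> c F G s t y\<bar> \<le> \<theta>"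
        and emp: "\<rho> \<le> emp (\<lambda>i. X m i \<omega>) m (T + 1) {y. \<eta> < \<bar>F y - G y\<bar>}"
      define J where "J = {nat \<lceil>real m * c\<rceil>..nat \<lfloor>real m * c'\<rfloor>}"
      define k where "k = nat \<lfloor>real m * (T + 1)\<rfloor>"
      \<comment> \<open>\<open>m1\<close> leaves room for the offset \<open>j + 1 \<le> k\<close>;
        \<open>m2\<close> makes \<open>J\<close> large enough to exceed \<open>C\<close> when each
        split point contributes \<open>C0\<close>, the 2 covering the rounding of its
        endpoints.\<close>
      have m1: "1 < real m * (T + 1) - real m * c'" and m2: "C / C0 + 2 < real m * c' - real m * c"
        using m c' by (auto simp: divide_less_eq algebra_simps)
      have m3: "real m \<le> real m * c" "real m * c < real m * c'" using m c c' by auto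
      have J_iff: "j \<in> J \<longleftrightarrow> real m * c \<le> real j \<and> real j \<le> real m * c'" for j
        unfolding J_def using m3 by (auto simp: nat_le_iff le_nat_iff ceiling_le_iff le_floor_iff)
      have J_sub: "J \<subseteq> {m..k - 1}"
      proof
        fix j assume "j \<in> J"
        then have j: "real m * c \<le> real j" "real j \<le> real m * c'" by (auto simp: J_iff)
        have "real m \<le> real j" using j m3 by linarith
        moreover have "real j + 1 \<le> real m * (T + 1)" using j m1 by linarith
        then have "int (j + 1) \<le> \<lfloor>real m * (T + 1)\<rfloor>" by (simp add: le_floor_iff)
        then have "j + 1 \<le> k" unfolding k_def by linarith
        ultimately show "j \<in> {m..k - 1}" by auto
      qed
      have card: "real m * c' - real m * c - 1 \<le> real (card J)"
      proof -
        have "real (card J) = real (nat \<lfloor>real m * c'\<rfloor> + 1 - nat \<lceil>real m * c\<rceil>)" by (simp add: J_def)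
        also have "\<dots> \<ge> real (nat \<lfloor>real m * c'\<rfloor>) + 1 - real (nat \<lceil>real m * c\<rceil>)" by linarith
        finally have "real (nat \<lfloor>real m * c'\<rfloor>) + 1 - real (nat \<lceil>real m * c\<rceil>) \<le> real (card J)" .
        moreover have "real (nat \<lfloor>real m * c'\<rfloor>) = of_int \<lfloor>real m * c'\<rfloor>" "real (nat \<lceil>real m * c\<rceil>) = of_int \<lceil>real m * c\<rceil>"
          using m3 by simp_all
        ultimately show ?thesis by linarith
      qed
      have "C / C0 < real (card J)" using card m2 by linarith
      have "C < real (card J) * (\<theta>\<^sup>2 * \<rho> / (T + 1))"
        using \<open>C / C0 < real (card J)\<close> C0 unfolding C0_def[symmetric] by (simp add: divide_less_eq)
      also have "\<dots> \<le> T_det \<gamma> \<delta> m (\<lambda>i. X m i \<omega>) (nat \<lfloor>real m * (T + 1)\<rfloor>)"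
      proof (rule T_det_lower_bound[OF _ _ _ _ _ _ emp])
        show "0 < m" "0 \<le> T + 1" "0 \<le> \<theta>" using m c \<theta> by auto
        show "J \<subseteq> {m..nat \<lfloor>real m * (T + 1)\<rfloor> - 1}" using J_sub by (simp add: k_def)
        have "real m + 1 \<le> real m * (T + 1)" using m1 m3 by linarith
        then have "int (m + 1) \<le> \<lfloor>real m * (T + 1)\<rfloor>" by (simp add: le_floor_iff)
        then show "m < nat \<lfloor>real m * (T + 1)\<rfloor>" by linarith
        fix j y assume "j \<in> J" and y: "y \<in> {y. \<eta> < \<bar>F y - G y\<bar>}"
        then have j: "c \<le> real j / real m" "real j / real m \<le> c'"
          using m by (auto simp: J_iff field_simps)
        then have "(real j / real m, T + 1) \<in> Delta T" using c c' by (auto simp: Delta_def)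
        with close have "\<bar>real m powr (- 1 / 2) * Hq_proc \<gamma> \<delta> m (\<lambda>i. X m i \<omega>) (real j / real m) (T + 1) y -
            Kq_lim \<gamma> \<delta> c F G (real j / real m) (T + 1) y\<bar> \<le> \<theta>" by blast
        with Kq[OF j, of y] y
        show "\<theta> \<le> \<bar>real m powr (- 1 / 2) * Hq_proc \<gamma> \<delta> m (\<lambda>i. X m i \<omega>) (real j / real m) (T + 1) y\<bar>"
          by simp
      qed
      finally show "C < T_det \<gamma> \<delta> m (\<lambda>i. X m i \<omega>) (nat \<lfloor>real m * (T + 1)\<rfloor>)" .
    qed
  qed
qed

lemma eventually_m_less_n: "\<forall>\<^sub>F m in sequentially. 0 < m \<and> m < nat \<lfloor>real m * (T + 1)\<rfloor>"
proof -
  have T: "0 < T" using c by linarith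
  have "\<forall>\<^sub>F m in sequentially. 1 / T < real m"
    using filterlim_real_sequentially unfolding filterlim_at_top_dense by blast
  then show ?thesis using eventually_gt_at_top[of 0]
  proof eventually_elim
    case (elim m)
    then have "real m + 1 \<le> real m * (T + 1)" using T by (simp add: field_simps)
    then have "int (m + 1) \<le> \<lfloor>real m * (T + 1)\<rfloor>" by (simp add: le_floor_iff)
    then show ?case using elim by linarith
  qed
qed

lemma S_det_diverges: "diverges_in_prob M (\<lambda>m \<omega>. S_det \<gamma> \<delta> m (\<lambda>i. X m i \<omega>) (nat \<lfloor>real m * (T + 1)\<rfloor>))"
proof (rule diverges_in_prob_mono[OF T_det_diverges])
  fix C
  show "\<exists>C'. \<forall>\<^sub>F m in sequentially. \<forall>\<omega>\<in>space M. C' < T_det \<gamma> \<delta> m (\<lambda>i. X m i \<omega>) (nat \<lfloor>real m * (T + 1)\<rfloor>) \<longrightarrow>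
      C < S_det \<gamma> \<delta> m (\<lambda>i. X m i \<omega>) (nat \<lfloor>real m * (T + 1)\<rfloor>)"
    using eventually_m_less_n
  \<comment> \<open>The factor in front of \<open>S_det\<close> is at most \<open>T\<close>;
    replacing it by \<open>T\<close> enlarges the threshold only if the threshold is nonnegative,
    hence \<open>max C 0\<close>.\<close>
  proof (intro exI[of _ "T * max C 0"], eventually_elim, intro ballI impI)
    fix m \<omega>
    define k where "k = nat \<lfloor>real m * (T + 1)\<rfloor>"
    define S where "S = S_det \<gamma> \<delta> m (\<lambda>i. X m i \<omega>) k"
    assume m: "0 < m \<and> m < nat \<lfloor>real m * (T + 1)\<rfloor>"
      and "T * max C 0 < T_det \<gamma> \<delta> m (\<lambda>i. X m i \<omega>) (nat \<lfloor>real m * (T + 1)\<rfloor>)"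
    then have *: "T * max C 0 < (real k - real m) / real m * S"
      using T_det_le_S_det[of m k \<gamma> \<delta> "\<lambda>i. X m i \<omega>"] by (simp add: k_def S_def)
    have r: "0 \<le> (real k - real m) / real m" "(real k - real m) / real m \<le> T"
      using m floor_div_bounds(1)[of m "T + 1"] c by (auto simp: k_def diff_divide_distrib)
    have "max C 0 < S"
    proof (rule ccontr)
      assume "\<not> max C 0 < S"
      then have "(real k - real m) / real m * S \<le> (real k - real m) / real m * max C 0"
        using r by (intro mult_left_mono) auto
      also have "\<dots> \<le> T * max C 0" using r by (intro mult_right_mono) auto
      finally show False using * by linarith
    qed
    then show "C < S_det \<gamma> \<delta> m (\<lambda>i. X m i \<omega>) (nat \<lfloor>real m * (T + 1)\<rfloor>)" by (simp add: S_def k_def)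
  qed
qed

lemma R_det_diverges: "diverges_in_prob M (\<lambda>m \<omega>. R_det \<gamma> \<delta> m (\<lambda>i. X m i \<omega>) (nat \<lfloor>real m * (T + 1)\<rfloor>))"
proof (rule diverges_in_prob_mono[OF S_det_diverges])
  fix C
  show "\<exists>C'. \<forall>\<^sub>F m in sequentially. \<forall>\<omega>\<in>space M. C' < S_det \<gamma> \<delta> m (\<lambda>i. X m i \<omega>) (nat \<lfloor>real m * (T + 1)\<rfloor>) \<longrightarrow>
      C < R_det \<gamma> \<delta> m (\<lambda>i. X m i \<omega>) (nat \<lfloor>real m * (T + 1)\<rfloor>)"
    using eventually_m_less_n
  \<comment> \<open>Squares compare correctly for \<open>C\<close> of either sign because
    \<open>R_det\<close> is nonnegative.\<close>
  proof (intro exI[of _ "C\<^sup>2"], eventually_elim, intro ballI impI)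
    fix m \<omega>
    assume m: "0 < m \<and> m < nat \<lfloor>real m * (T + 1)\<rfloor>"
      and "C\<^sup>2 < S_det \<gamma> \<delta> m (\<lambda>i. X m i \<omega>) (nat \<lfloor>real m * (T + 1)\<rfloor>)"
    then have "C\<^sup>2 < (R_det \<gamma> \<delta> m (\<lambda>i. X m i \<omega>) (nat \<lfloor>real m * (T + 1)\<rfloor>))\<^sup>2"
      using S_det_le_R_det_squared(2)[of m _ \<delta> \<gamma> "\<lambda>i. X m i \<omega>"] \<delta> by (meson less_le_trans)
    then show "C < R_det \<gamma> \<delta> m (\<lambda>i. X m i \<omega>) (nat \<lfloor>real m * (T + 1)\<rfloor>)"
      using S_det_le_R_det_squared(1)[of m _ \<delta> \<gamma> "\<lambda>i. X m i \<omega>"] \<delta> m by (blast intro: power_less_imp_less_base)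
  qed
qed

lemma SUP_det_proc_diverges:
  assumes "diverges_in_prob M (\<lambda>m \<omega>. D m \<omega> (nat \<lfloor>real m * (T + 1)\<rfloor>))"
  shows "diverges_in_prob M (\<lambda>m \<omega>. SUP t\<in>{1..T + 1}. det_proc (D m \<omega>) m t)"
proof (rule diverges_in_prob_mono[OF assms], intro exI always_eventually allI ballI impI)
  fix C m \<omega>
  assume "C < D m \<omega> (nat \<lfloor>real m * (T + 1)\<rfloor>)"
  also have "\<dots> \<le> (SUP t\<in>{1..T + 1}. det_proc (D m \<omega>) m t)"
    using c by (intro SUP_det_proc_ge) simp
  finally show "C < (SUP t\<in>{1..T + 1}. det_proc (D m \<omega>) m t)" .
qed

end

theorem proposition2p7:
  fixes M :: "'a measure"
    and X :: "nat \<Rightarrow> nat \<Rightarrow> 'a \<Rightarrow> real ^ 'd"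
    and Y Z :: "int \<Rightarrow> 'a \<Rightarrow> real ^ 'd"
    and F G :: "real ^ 'd \<Rightarrow> real"
    and T c a b \<gamma> \<delta> :: real
  assumes "prob_space M"
    and "T > 0" and "1 \<le> c" and "c < T + 1"
    and "0 < \<delta>" and "\<delta> < 1" and "0 \<le> \<gamma>" and "\<gamma> \<le> 1 / 2"
    and "stationary_seq M Y" and "\<And>i. continuous_rv M (Y i)" and "\<And>i. dist_fun M (Y i) = F"
    and "a > 1" and "strong_mixing_coeff M Y \<in> O(\<lambda>r. real r powr (- a))"
    and "stationary_seq M Z" and "\<And>i. continuous_rv M (Z i)" and "\<And>i. dist_fun M (Z i) = G"
    and "b > 1" and "strong_mixing_coeff M Z \<in> O(\<lambda>r. real r powr (- b))"
    and "G \<noteq> F"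
    and "\<And>m i \<omega>. \<omega> \<in> space M \<Longrightarrow> i \<in> {1..nat \<lfloor>real m * c\<rfloor>} \<Longrightarrow> X m i \<omega> = Y (int i) \<omega>"
    and "\<And>m i \<omega>. \<omega> \<in> space M \<Longrightarrow> i \<in> {nat \<lfloor>real m * c\<rfloor> + 1..nat \<lfloor>real m * (T + 1)\<rfloor>} \<Longrightarrow>
           X m i \<omega> = Z (int i) \<omega>"
  shows "converges_in_prob M (linf (Delta T \<times> UNIV))
           (\<lambda>m \<omega>. restrict_Delta T
              (\<lambda>s t y. real m powr (- 1 / 2) * H_proc m (\<lambda>i. X m i \<omega>) s t y))
           (restrict_Delta T (K_lim c F G))
       \<and> converges_in_prob M (linf (Delta T \<times> UNIV))
           (\<lambda>m \<omega>. restrict_Delta T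
              (\<lambda>s t y. real m powr (- 1 / 2) * Hq_proc \<gamma> \<delta> m (\<lambda>i. X m i \<omega>) s t y))
           (restrict_Delta T (Kq_lim \<gamma> \<delta> c F G))
       \<and> diverges_in_prob M
           (\<lambda>m \<omega>. SUP t\<in>{1..T + 1}. det_proc (R_det \<gamma> \<delta> m (\<lambda>i. X m i \<omega>)) m t)
       \<and> diverges_in_prob M
           (\<lambda>m \<omega>. SUP t\<in>{1..T + 1}. det_proc (S_det \<gamma> \<delta> m (\<lambda>i. X m i \<omega>)) m t)
       \<and> diverges_in_prob M
           (\<lambda>m \<omega>. SUP t\<in>{1..T + 1}. det_proc (T_det \<gamma> \<delta> m (\<lambda>i. X m i \<omega>)) m t)"
proof -
  interpret change_point M Y Z a b X F G T c \<gamma> \<delta>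
    using assms by (simp add: change_point_def change_point_axioms_def mixing_seq_def mixing_seq_axioms_def)
  show ?thesis
    using H_converges Hq_converges R_det_diverges S_det_diverges T_det_diverges
    by (simp add: SUP_det_proc_diverges)
qed

end
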